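(* Let $q,p\in(0,2]$ and, for $\lambda>0$, $\Phi_\lambda(U,V)=F(UV^T)+\frac\lambda q\|U\|_{2,q}^q+\frac\lambda p\|V\|_{2,p}^p$ on $\mathbb{R}^{m\times d}\times\mathbb{R}^{n\times d}$. Let $\{(U^k,V^k)\}_{k\ge0}$ be an infinite sequence generated by the inexact proximal alternating linearized minimization method (described in the context) with tolerances satisfying $\sum_{k=0}^\infty\sqrt{\delta_k}<+\infty$. Assume: (A1) $F$ is continuously differentiable, proper and bounded below; (A2) $\Phi_{\lambda_0}$ has a critical point; (A3) $\nabla F^k$ and $\nabla\bar F^k$ are Lipschitz continuous with constants $L_1^k/2$ and $L_2^k/2$ respectively, and there are constants $0<l<L<+\infty$ with $l\le L_1^k,L_2^k\le L$ for all $k$; (C) the weights $\beta_k$ are such that $\Phi_\lambda^{k+1}(U^{k+1},V^{k+1})\le\Phi_\lambda^{k+1}(U^k,V^k)$, and there is $\delta_\beta<1$ such that $0\le\beta_k\le\frac16\delta_\beta\min\left\{\sqrt{L_1^{k-1}/L_1^k},\sqrt{L_2^{k-1}/L_2^k}\right\}$ uniformly over all $k$. Let $\bar W=(\bar U;\bar V)$ be a limit point of $W^k=(U^k;V^k)$ and suppose that: 1. $\nabla_UF(U,V)$ and $\nabla_VF(U,V)$ are Lipschitz continuous with respect to $(U,V)$, with constant $L^*$, within the ball $\mathbb{B}_{4\rho}((\bar U,\bar V))$; 2. there is a sufficiently large $K$ such that for all $k\ge K$, $$\Phi_\lambda^k(U^k,V^k)-\Phi_\lambda^k(\bar U,\bar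 V)\ge\Phi_\lambda^{k+1}(U^{k+1},V^{k+1})-\Phi_\lambda^{k+1}(\bar U,\bar V)>0;$$ 3. there is a sufficiently large $K$ such that for all $k\ge K$, $\Phi_\lambda^k$ has the KL property at $(\bar U,\bar V)$ with the same function $\varphi(s)=\mu s^{1-\theta}$ and the same parameters $\rho,\eta,\theta,\mu$ (the same $\rho$ as in condition 1). Put $L_H=\max\{L^*,L\}$, let $C_0$ be a constant with $0<C_0<1-\delta_\beta$, and let $$a=\frac1{1-\delta_\beta-C_0},\qquad b=\frac{\mu\left(3\sqrt{8/l}\,\mu(1-\theta)L_H\right)^{\frac{1-\theta}\theta}}{1-\delta_\beta-C_0}.$$ Suppose $\delta_k\le\gamma\beta^{2k}$ for all $k$, for some constants $\gamma>0$ and $0<\beta\le\sqrt{\frac{a+b-1}{a+b}}$. Then: (i) if $0<\theta\le\frac12$, there exist $C>0$ and $0<\alpha<1$ such that $\|W^k-\bar W\|_F\le C\alpha^k$ for all sufficiently large $k$; (ii) if $\frac12<\theta<1$, there exists $C>0$ such that $\|W^k-\bar W\|_F\le C\,k^{-(1-\theta)/(2\theta-1)}$ for all sufficiently large $k$.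
   Context: Notation: $A_t=A_{:,t}$ is the $t$-th column of $A$; $\|A\|_{2,q}^q=\sum_t\|A_t\|_2^q$; $F(U,V):=F(UV^T)$; $F^k(U)=F(U,V^k)$, $\bar F^k(V)=F(U^{k+1},V)$; $\operatorname{prox}_h(x)=\arg\min_y\frac12\|y-x\|^2+h(y)$; $\partial$ is the limiting Fréchet subdifferential, and a critical point of $\Phi$ is a point with $0\in\partial\Phi$. Algorithm (inexact proximal alternating linearized minimization). Choose $\lambda^0>\lambda_0>0$, $\varrho\in(0,1)$, a bound $\beta^*\geq 0$, step parameters $L_1^k,L_2^k>0$, tolerances $\delta_k\in[0,\frac14]$ with $\delta_k\to0$ and $\sum_k\delta_k<\infty$, and $(U^{-1},V^{-1})=(U^0,V^0)$. At iteration $k\geq 0$, with extrapolation weight $\beta_k\in[0,\beta^*]$, put $\widetilde U^k=U^k+\beta_k(U^k-U^{k-1})$, $\widetilde V^k=V^k+\beta_k(V^k-V^{k-1})$. First $U^{k+1}$ is a (possibly inexact) minimizer over $U$ of $\langle\nabla F^k(\widetilde U^k),U-\widetilde U^k\rangle+\frac{L_1^k}2\|U-\widetilde U^k\|_F^2+\frac{\lambda^k}q\|U\|_{2,q}^q$, then $V^{k+1}$ is a (possibly inexact) minimizer over $V$ of $\langle\nabla\bar F^k(\widetilde V^k),V-\widetilde V^k\rangle+\frac{L_2^k}2\|V-\widetilde V^k\|_F^2+\frac{\lambda^k}p\|V\|_{2,p}^p$. Inexactness with tolerance $\delta_k$ means that there are $\lambda_{1,t}^k,\lambda_{2,t}^k>0$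 ($t=1,\dots,d$) with $$U_t^{k+1}\in\operatorname{prox}_{\frac{\lambda_{1,t}^k}{qL_1^k}\|\cdot\|_2^q}\left(\left(\widetilde U^k-\tfrac1{L_1^k}\nabla F^k(\widetilde U^k)\right)_t\right),\qquad V_t^{k+1}\in\operatorname{prox}_{\frac{\lambda_{2,t}^k}{pL_2^k}\|\cdot\|_2^p}\left(\left(\widetilde V^k-\tfrac1{L_2^k}\nabla\bar F^k(\widetilde V^k)\right)_t\right),$$ $$\left|\left(\lambda^k/\lambda_{1,t}^k\right)^{\frac1{q+1}}-1\right|\le\delta_k,\qquad\left|\left(\lambda^k/\lambda_{2,t}^k\right)^{\frac1{p+1}}-1\right|\le\delta_k$$ (exact solution: $\lambda_{i,t}^k=\lambda^k$). Then $\lambda^{k+1}=\max\{\varrho\lambda^k,\lambda_0\}$. Rank adjustment: zero columns of $U^{k+1}$ or $V^{k+1}$ are removed (same column indices in all iterates in use) and $d$ is decreased; this happens only finitely often, and statements about the sequence refer to iterates after $d$ has become constant. The stopping test is disregarded. Perturbed objective: $\Phi_\lambda^{k+1}(U,V)=F(UV^T)+\sum_{t=1}^d\frac{\lambda_{1,t}^k}q\|U_t\|_2^q+\sum_{t=1}^d\frac{\lambda_{2,t}^k}p\|V_t\|_2^p$. KL property of $f$ at $\bar x$ with parameters $\rho>0$, $\eta\in(0,+\infty]$, $\theta\in[0,1)$, $\mu>0$: with $\varphi(s)=\mu s^{1-\theta}$, $\varphi'(f(x)-f(\bar x))\operatorname{dist}(0,\partial f(x))\ge1$ for every $x$ with $\|x-\bar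 x\|_2\le\rho$ and $f(\bar x)<f(x)<f(\bar x)+\eta$. $\mathbb{B}_{4\rho}(\bar x)$ is the ball of radius $4\rho$ about $\bar x$. *)

theory Defs
  imports "HOL-Analysis.Analysis"
begin

section \<open>Gradients, proximal maps, subdifferentials, the KL property\<close>

definition gradient :: "('a::real_inner \<Rightarrow> real) \<Rightarrow> 'a \<Rightarrow> 'a" where
  "gradient f x = (THE D. GDERIV f x :> D)"

text \<open>The proximal map is set-valued, since \<open>h\<close> need not be convex.\<close>

definition prox :: "('a::real_inner \<Rightarrow> real) \<Rightarrow> 'a \<Rightarrow> 'a set" where
  "prox h x = {y. is_arg_min (\<lambda>y. 1 / 2 * (norm (y - x))\<^sup>2 + h y) (\<lambda>_. True) y}"

definition frechet_subdiff :: "('a::real_inner \<Rightarrow> real) \<Rightarrow> 'a \<Rightarrow> 'a set" where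
  "frechet_subdiff f x =
     {v. Liminf (at x) (\<lambda>y. ereal ((f y - f x - inner v (y - x)) / norm (y - x))) \<ge> 0}"

definition limiting_subdiff :: "('a::real_inner \<Rightarrow> real) \<Rightarrow> 'a \<Rightarrow> 'a set" where
  "limiting_subdiff f x =
     {v. \<exists>xs vs. xs \<longlonglongrightarrow> x \<and> (\<lambda>j. f (xs j)) \<longlonglongrightarrow> f x \<and>
          (\<forall>j::nat. vs j \<in> frechet_subdiff f (xs j)) \<and> vs \<longlonglongrightarrow> v}"

definition critical_point :: "('a::real_inner \<Rightarrow> real) \<Rightarrow> 'a \<Rightarrow> bool" where
  "critical_point f x \<longleftrightarrow> 0 \<in> limiting_subdiff f x"

text \<open>The distance from the origin is extended-valued, so that it is \<open>\<infinity>\<close> for the empty set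
  (\<^const>\<open>infdist\<close> and \<^const>\<open>setdist\<close> would give \<open>0\<close> there).\<close>

definition dist_zero :: "'a::real_normed_vector set \<Rightarrow> ereal" where
  "dist_zero S = (INF v\<in>S. ereal (norm v))"

definition KL_property ::
  "('a::real_inner \<Rightarrow> real) \<Rightarrow> 'a \<Rightarrow> real \<Rightarrow> ereal \<Rightarrow> real \<Rightarrow> real \<Rightarrow> bool" where
  "KL_property f xbar \<rho> \<eta> \<theta> \<mu> \<longleftrightarrow>
     \<rho> > 0 \<and> \<eta> > 0 \<and> 0 \<le> \<theta> \<and> \<theta> < 1 \<and> \<mu> > 0 \<and>
     (\<forall>x. norm (x - xbar) \<le> \<rho> \<and> f xbar < f x \<and> ereal (f x) < ereal (f xbar) + \<eta> \<longrightarrow>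
        ereal (deriv (\<lambda>s. \<mu> * s powr (1 - \<theta>)) (f x - f xbar)) * dist_zero (limiting_subdiff f x)
          \<ge> 1)"

section \<open>The objective and its perturbations\<close>

text \<open>An \<open>m \<times> d\<close> matrix has type \<open>real ^ 'd ^ 'm\<close>; \<^const>\<open>norm\<close> is then the Frobenius norm, and on pairs
  of matrices the Frobenius norm of the stacked matrix. The following is the \<open>q\<close>-th power of the
  \<open>(2,q)\<close>-norm.\<close>

definition norm2_pow :: "real \<Rightarrow> real ^ 'd ^ 'm \<Rightarrow> real" where
  "norm2_pow q A = (\<Sum>t\<in>UNIV. norm (column t A) powr q)"

definition \<Phi> ::
  "(real ^ 'n ^ 'm \<Rightarrow> real) \<Rightarrow> real \<Rightarrow> real \<Rightarrow> real \<Rightarrow> (real ^ 'd ^ 'm) \<times> (real ^ 'd ^ 'n) \<Rightarrow> real" where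
  "\<Phi> F q p lam = (\<lambda>(U, V). F (U ** transpose V) + lam / q * norm2_pow q U + lam / p * norm2_pow p V)"

definition \<Phi>_cols ::
  "(real ^ 'n ^ 'm \<Rightarrow> real) \<Rightarrow> real \<Rightarrow> real \<Rightarrow> ('d \<Rightarrow> real) \<Rightarrow> ('d \<Rightarrow> real) \<Rightarrow>
     (real ^ 'd ^ 'm) \<times> (real ^ 'd ^ 'n) \<Rightarrow> real" where
  "\<Phi>_cols F q p w1 w2 = (\<lambda>(U, V). F (U ** transpose V)
     + (\<Sum>t\<in>UNIV. w1 t / q * norm (column t U) powr q)
     + (\<Sum>t\<in>UNIV. w2 t / p * norm (column t V) powr p))"

text \<open>The perturbed objective with upper index \<open>k \<ge> 1\<close> carries the column weights of iteration
  \<open>k - 1\<close>; the value at \<open>k = 0\<close> has no meaning.\<close>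

definition \<Phi>_pert ::
  "(real ^ 'n ^ 'm \<Rightarrow> real) \<Rightarrow> real \<Rightarrow> real \<Rightarrow> (nat \<Rightarrow> 'd \<Rightarrow> real) \<Rightarrow> (nat \<Rightarrow> 'd \<Rightarrow> real) \<Rightarrow> nat \<Rightarrow>
     (real ^ 'd ^ 'm) \<times> (real ^ 'd ^ 'n) \<Rightarrow> real" where
  "\<Phi>_pert F q p lam1 lam2 k = \<Phi>_cols F q p (lam1 (k - 1)) (lam2 (k - 1))"

definition grad_U ::
  "(real ^ 'n ^ 'm \<Rightarrow> real) \<Rightarrow> real ^ 'd ^ 'm \<Rightarrow> real ^ 'd ^ 'n \<Rightarrow> real ^ 'd ^ 'm" where
  "grad_U F U V = gradient (\<lambda>X. F (X ** transpose V)) U"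

definition grad_V ::
  "(real ^ 'n ^ 'm \<Rightarrow> real) \<Rightarrow> real ^ 'd ^ 'm \<Rightarrow> real ^ 'd ^ 'n \<Rightarrow> real ^ 'd ^ 'n" where
  "grad_V F U V = gradient (\<lambda>Y. F (U ** transpose Y)) V"

section \<open>The algorithm\<close>

text \<open>Extrapolated iterate. As subtraction on \<^typ>\<open>nat\<close> truncates, \<open>X (0 - 1) = X 0\<close>, which is the
  initial convention that the iterates with index \<open>-1\<close> and \<open>0\<close> agree.\<close>

definition extrapolate :: "(nat \<Rightarrow> real) \<Rightarrow> (nat \<Rightarrow> 'a::real_vector) \<Rightarrow> nat \<Rightarrow> 'a" where
  "extrapolate w X k = X k + w k *\<^sub>R (X k - X (k - 1))"

text \<open>
  Infinite sequences generated by the inexact proximal alternating linearized minimization method.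

  The rank adjustment removes columns only finitely often. Let \<open>k0\<close> be an index from which on the
  number of columns no longer changes (\<open>k0 = 0\<close> if nothing is ever removed), and let \<open>'d\<close> index the
  remaining columns. \<open>U k\<close>, \<open>V k\<close> are the iterates, restricted to these columns as soon as they
  are used in the iterations \<open>k \<ge> k0\<close>; this concerns \<open>k \<ge> k0\<close> and, because of extrapolation,
  \<open>k0 - 1\<close>. Nothing is required of earlier iterates. That no column is removed any more, and that
  those zero at an earlier stage are gone, means that the iterates have no zero column; only the
  initial point has not passed through the adjustment.

  The scalar parameters do not depend on the number of columns and follow their rules from the
  start. The scalars are: \<open>lam0\<close> the final regularization parameter, \<open>lam\<close> the sequence of
  regularization parameters, \<open>\<rho>\<close> its reduction factor, \<open>bmax\<close> the bound on the extrapolation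
  weights \<open>bw\<close>, \<open>\<delta>\<close> the tolerances, \<open>lam1\<close> and \<open>lam2\<close> the column weights that the inexact
  solution of the subproblems admits.
\<close>

definition inexact_PALM ::
  "(real ^ 'n ^ 'm \<Rightarrow> real) \<Rightarrow> real \<Rightarrow> real \<Rightarrow> nat \<Rightarrow> real \<Rightarrow> real \<Rightarrow> real \<Rightarrow> (nat \<Rightarrow> real) \<Rightarrow>
     (nat \<Rightarrow> real) \<Rightarrow> (nat \<Rightarrow> real) \<Rightarrow> (nat \<Rightarrow> real) \<Rightarrow> (nat \<Rightarrow> real) \<Rightarrow>
     (nat \<Rightarrow> 'd \<Rightarrow> real) \<Rightarrow> (nat \<Rightarrow> 'd \<Rightarrow> real) \<Rightarrow>
     (nat \<Rightarrow> real ^ 'd ^ 'm) \<Rightarrow> (nat \<Rightarrow> real ^ 'd ^ 'n) \<Rightarrow> bool" where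
  "inexact_PALM F q p k0 lam0 \<rho> bmax lam bw L1 L2 \<delta> lam1 lam2 U V \<longleftrightarrow>
     0 < lam0 \<and> lam0 < lam 0 \<and> 0 < \<rho> \<and> \<rho> < 1 \<and> 0 \<le> bmax \<and>
     (\<forall>k. lam (Suc k) = max (\<rho> * lam k) lam0) \<and>
     (\<forall>k. 0 \<le> bw k \<and> bw k \<le> bmax) \<and>
     (\<forall>k. 0 < L1 k \<and> 0 < L2 k) \<and>
     (\<forall>k. 0 \<le> \<delta> k \<and> \<delta> k \<le> 1 / 4) \<and> \<delta> \<longlonglongrightarrow> 0 \<and> summable \<delta> \<and>
     (\<forall>k\<ge>k0. \<forall>t.
        0 < lam1 k t \<and> 0 < lam2 k t \<and>
        column t (U (Suc k)) \<in> prox (\<lambda>y. lam1 k t / (q * L1 k) * norm y powr q)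
          (column t (extrapolate bw U k
             - (1 / L1 k) *\<^sub>R grad_U F (extrapolate bw U k) (V k))) \<and>
        column t (V (Suc k)) \<in> prox (\<lambda>y. lam2 k t / (p * L2 k) * norm y powr p)
          (column t (extrapolate bw V k
             - (1 / L2 k) *\<^sub>R grad_V F (U (Suc k)) (extrapolate bw V k))) \<and>
        \<bar>(lam k / lam1 k t) powr (1 / (q + 1)) - 1\<bar> \<le> \<delta> k \<and>
        \<bar>(lam k / lam2 k t) powr (1 / (p + 1)) - 1\<bar> \<le> \<delta> k) \<and>
     (\<forall>k\<ge>k0. k \<ge> 1 \<longrightarrow> (\<forall>t. column t (U k) \<noteq> 0 \<and> column t (V k) \<noteq> 0))"

end

theory Submission
  imports Defs
begin

text \<open>
  Let \<open>s k\<close> be the size of the step from \<open>W k\<close> to \<open>W (k + 1)\<close>, weighted by the step parameters, and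
  let \<open>r k\<close> be the excess of the \<open>k\<close>-th perturbed objective at \<open>W k\<close> over its value at the limit point.
  The proximal steps give \<open>s (k + 1)\<^sup>2 \<le> s k\<^sup>2 / 4 + (r (k + 1) - r (k + 2)) + e\<close>, where the change of
  the column weights costs an error \<open>e\<close> of the order of the tolerances; the iterates enter \<open>e\<close> only
  through their penalty, which is bounded because the objectives are. As no iterate has a zero column,
  the perturbed objectives are differentiable along the sequence, and optimality in the proximal steps
  bounds their gradients by \<open>s (k - 1) + s (k - 2)\<close>. The Kurdyka-Lojasiewicz inequality and the
  concavity of \<open>\<phi>\<close> then yield \<open>s k / 4 \<le> P (k - 2) - P (k - 1)\<close> for a potential \<open>P\<close> that combines two
  step sizes, \<open>\<phi> (r k)\<close> and the geometric tail of the errors. Hence the sequence is trapped near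
  the limit point, \<open>P\<close> dominates the distance to it, and the Kurdyka-Lojasiewicz inequality, read as
  a bound of \<open>P (k + 2)\<close> by a power of \<open>P k - P (k + 2)\<close>, gives the rates.
\<close>

section \<open>Gradients and proximal gradient steps\<close>

lemma gradient_eq:
  assumes "GDERIV f x :> D"
  shows "gradient f x = D"
  unfolding gradient_def
proof (rule the_equality, rule assms)
  fix D' assume "GDERIV f x :> D'"
  then have "(\<lambda>h. inner h D') = (\<lambda>h. inner h D)"
    using assms unfolding gderiv_def by (rule has_derivative_unique)
  then have "inner (D' - D) D' = inner (D' - D) D" by metis
  then show "D' = D" by (metis inner_diff_right inner_eq_zero_iff right_minus_eq)
qed

lemma GDERIV_gradient:
  fixes f :: "'a::euclidean_space \<Rightarrow> real"
  assumes "f differentiable (at x)"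
  shows "GDERIV f x :> gradient f x"
proof -
  obtain f' where f': "(f has_derivative f') (at x)"
    using assms unfolding differentiable_def by blast
  \<comment> \<open>The adjoint of a linear functional, applied to 1, is its Riesz
    representative.\<close>
  have "f' = (\<lambda>h. inner h (adjoint f' 1))"
    using adjoint_works[OF has_derivative_linear[OF f'], of _ 1] by auto
  then have "GDERIV f x :> adjoint f' 1"
    using f' unfolding gderiv_def by metis
  then show ?thesis using gradient_eq by metis
qed

text \<open>Along the segment from \<open>x\<close> to \<open>y\<close>, the function minus the
  claimed quadratic bound has nonpositive derivative, by Cauchy-Schwarz and the Lipschitz bound.
  Comparing the end points needs no integral of the gradient.\<close>

lemma descent_lemma:
  fixes f :: "'a::real_inner \<Rightarrow> real"
  assumes D: "\<And>x. GDERIV f x :> f' x" and lip: "M-lipschitz_on UNIV f'"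
  shows "f y \<le> f x + inner (f' x) (y - x) + M / 2 * (norm (y - x))\<^sup>2"
proof -
  define d where "d = y - x"
  define h where "h t = f (x + t *\<^sub>R d) - t * inner (f' x) d - M / 2 * t\<^sup>2 * (norm d)\<^sup>2" for t
  have "h 1 \<le> h 0"
  proof (rule DERIV_nonpos_imp_nonincreasing[of 0 1 h], simp, intro exI conjI)
    fix t :: real assume t: "0 \<le> t" "t \<le> 1"
    have "((\<lambda>t. f (x + t *\<^sub>R d)) has_derivative (\<lambda>s. inner (s *\<^sub>R d) (f' (x + t *\<^sub>R d)))) (at t)"
      by (rule has_derivative_compose[where g = f, OF _ D[unfolded gderiv_def]])
        (auto intro!: derivative_eq_intros)
    then have "((\<lambda>t. f (x + t *\<^sub>R d)) has_real_derivative inner d (f' (x + t *\<^sub>R d))) (at t)"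
      unfolding has_field_derivative_def by (rule has_derivative_eq_rhs) (auto simp: mult.commute)
    then show "(h has_real_derivative inner d (f' (x + t *\<^sub>R d)) - inner (f' x) d - M * t * (norm d)\<^sup>2) (at t)"
      unfolding h_def[abs_def]
      by (auto intro!: derivative_eq_intros)
    have "inner d (f' (x + t *\<^sub>R d)) - inner (f' x) d = inner (f' (x + t *\<^sub>R d) - f' x) d"
      by (simp add: inner_diff_left inner_commute[of d])
    also have "\<dots> \<le> norm (f' (x + t *\<^sub>R d) - f' x) * norm d" by (rule norm_cauchy_schwarz)
    also have "\<dots> \<le> (M * norm (t *\<^sub>R d)) * norm d"
      using lipschitz_onD[OF lip, of "x + t *\<^sub>R d" x] by (intro mult_right_mono) (auto simp: dist_norm)
    finally show "inner d (f' (x + t *\<^sub>R d)) - inner (f' x) d - M * t * (norm d)\<^sup>2 \<le> 0"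
      using t by (simp add: power2_eq_square mult.assoc)
  qed
  then show ?thesis by (simp add: h_def d_def)
qed

section \<open>Extrapolated proximal gradient steps\<close>

lemma power2_norm_diff_ge:
  fixes a b :: "'a::real_inner"
  shows "(norm (a - b))\<^sup>2 \<ge> (norm a)\<^sup>2 / 2 - (norm b)\<^sup>2"
proof -
  \<comment> \<open>Half of this square is the difference of the two sides.\<close>
  have "(norm (a - 2 *\<^sub>R b))\<^sup>2 \<ge> 0" by simp
  then show ?thesis
    by (simp add: power2_norm_eq_inner inner_diff_left inner_diff_right inner_commute algebra_simps)
qed

text \<open>Neither function need be convex. The Lipschitz constant \<open>M / 2\<close> makes the
  descent lemma cost only \<open>M / 4\<close>, against the \<open>M / 2\<close> of the proximal
  term, so \<open>M / 4\<close> survives at \<open>z\<close> while \<open>3 / 4 * M\<close> is paid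
  at \<open>x\<close>. Replacing \<open>z - y\<close> by \<open>z - x\<close> halves the former and
  raises the price of extrapolation to \<open>M\<close>.\<close>

lemma prox_gradient_decrease:
  fixes f g :: "'a::real_inner \<Rightarrow> real"
  assumes D: "\<And>x. GDERIV f x :> f' x" and lip: "(M / 2)-lipschitz_on UNIV f'" and M: "M > 0"
    and y: "y = x + w *\<^sub>R (x - xp)"
    and min: "1 / 2 * (norm (z - (y - (1 / M) *\<^sub>R f' y)))\<^sup>2 + g z / M
       \<le> 1 / 2 * (norm (x - (y - (1 / M) *\<^sub>R f' y)))\<^sup>2 + g x / M"
  shows "f z + g z + M / 8 * (norm (z - x))\<^sup>2 \<le> f x + g x + M * w\<^sup>2 * (norm (x - xp))\<^sup>2"
proof -
  \<comment> \<open>Expanding the square turns the proximal objective into the linearized model plus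
    a term independent of \<open>v\<close>.\<close>
  have e: "M * (1 / 2 * (norm (v - (y - (1 / M) *\<^sub>R f' y)))\<^sup>2 + g v / M)
      = M / 2 * (norm (v - y))\<^sup>2 + inner (f' y) (v - y) + g v + (norm (f' y))\<^sup>2 / (2 * M)" for v
  proof -
    have "(norm (d + t *\<^sub>R n))\<^sup>2 = (norm d)\<^sup>2 + 2 * t * inner n d + t\<^sup>2 * (norm n)\<^sup>2"
      for d n :: 'a and t
      unfolding power2_norm_eq_inner
      by (simp add: inner_add_left inner_add_right inner_commute power2_eq_square)
    from this[of "v - y" "1 / M" "f' y"]
    have "(norm (v - (y - (1 / M) *\<^sub>R f' y)))\<^sup>2
        = (norm (v - y))\<^sup>2 + 2 / M * inner (f' y) (v - y) + (norm (f' y))\<^sup>2 / M\<^sup>2"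
      by (simp add: power_divide algebra_simps)
    then show ?thesis using M by (simp add: field_simps power2_eq_square)
  qed
  have "M / 2 * (norm (z - y))\<^sup>2 + inner (f' y) (z - y) + g z
     \<le> M / 2 * (norm (x - y))\<^sup>2 + inner (f' y) (x - y) + g x"
    using mult_left_mono[OF min, of M] M unfolding e by simp
  moreover have "f z \<le> f y + inner (f' y) (z - y) + M / 4 * (norm (z - y))\<^sup>2"
    using descent_lemma[OF D lip, of z y] by simp
  \<comment> \<open>The descent lemma for \<open>- f\<close> replaces convexity: it bounds the
    linearization at \<open>y\<close> above by \<open>f x\<close> plus a quadratic term.\<close>
  moreover have "- f x \<le> - f y + inner (- f' y) (x - y) + M / 4 * (norm (x - y))\<^sup>2"
    using descent_lemma[of "\<lambda>x. - f x" "\<lambda>x. - f' x" "M / 2" x y] GDERIV_minus[OF D]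
      lipschitz_on_minus[OF lip] by simp
  ultimately have 1: "f z + g z + M / 4 * (norm (z - y))\<^sup>2 \<le> f x + g x + M * 3 / 4 * (norm (x - y))\<^sup>2"
    by (simp add: inner_minus_left algebra_simps)
  have xy: "(norm (x - y))\<^sup>2 = w\<^sup>2 * (norm (x - xp))\<^sup>2"
    by (simp add: y power_mult_distrib)
  have "(norm (z - y))\<^sup>2 \<ge> (norm (z - x))\<^sup>2 / 2 - w\<^sup>2 * (norm (x - xp))\<^sup>2"
    using power2_norm_diff_ge[of "z - x" "w *\<^sub>R (x - xp)"]
    by (simp add: y power_mult_distrib diff_diff_eq)
  then have "M / 4 * (norm (z - y))\<^sup>2 \<ge> M / 4 * ((norm (z - x))\<^sup>2 / 2 - w\<^sup>2 * (norm (x - xp))\<^sup>2)"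
    using M by (intro mult_left_mono) auto
  then show ?thesis using 1 unfolding xy by (simp add: algebra_simps)
qed

text \<open>Stationarity at the minimizer \<open>z\<close> gives
  \<open>G = M *\<^sub>R (y - z) - f' y\<close>. The residual thus consists of a gradient
  difference, of size at most \<open>M / 2 * norm (z - y)\<close>, and the proximal term, of size
  \<open>M * norm (z - y)\<close>.\<close>

lemma prox_gradient_residual:
  fixes f g :: "'a::euclidean_space \<Rightarrow> real"
  assumes lip: "(M / 2)-lipschitz_on UNIV f'" and M: "M > 0"
    and y: "y = x + w *\<^sub>R (x - xp)" and w: "w \<ge> 0"
    and G: "GDERIV g z :> G"
    and min: "\<And>v. 1 / 2 * (norm (z - (y - (1 / M) *\<^sub>R f' y)))\<^sup>2 + g z / M
       \<le> 1 / 2 * (norm (v - (y - (1 / M) *\<^sub>R f' y)))\<^sup>2 + g v / M"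
  shows "norm (f' z + G) \<le> 3 / 2 * M * (norm (z - x) + w * norm (x - xp))"
proof -
  define c where "c = y - (1 / M) *\<^sub>R f' y"
  have "((\<lambda>v. 1 / 2 * (norm (v - c))\<^sup>2 + g v / M) has_derivative
       (\<lambda>h. inner h ((z - c) + (1 / M) *\<^sub>R G))) (at z)" (is "(?h has_derivative _) _")
    using G M unfolding gderiv_def power2_norm_eq_inner
    by (auto intro!: derivative_eq_intros simp: inner_add_right inner_commute)
  from has_derivative_local_min[OF this] have "(\<lambda>h. inner h ((z - c) + (1 / M) *\<^sub>R G)) = (\<lambda>h. 0)"
    using min by (simp add: c_def)
  then have "(z - c) + (1 / M) *\<^sub>R G = 0" by (metis inner_eq_zero_iff)
  then have "M *\<^sub>R ((z - c) + (1 / M) *\<^sub>R G) = 0" by simp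
  then have "G = M *\<^sub>R (y - z) - f' y"
    using M by (simp add: c_def algebra_simps)
  then have eq: "f' z + G = (f' z - f' y) + M *\<^sub>R (y - z)" by simp
  have "norm (f' z + G) \<le> norm (f' z - f' y) + norm (M *\<^sub>R (y - z))"
    unfolding eq by (rule norm_triangle_ineq)
  also have "norm (M *\<^sub>R (y - z)) = M * norm (z - y)"
    using M by (simp add: norm_minus_commute)
  also have "norm (f' z - f' y) \<le> M / 2 * norm (z - y)"
    using lipschitz_onD[OF lip, of z y] by (simp add: dist_norm)
  finally have "norm (f' z + G) \<le> 3 / 2 * M * norm (z - y)" by simp
  also have "norm (z - y) \<le> norm (z - x) + norm (w *\<^sub>R (x - xp))"
    using norm_triangle_ineq4[of "z - x" "w *\<^sub>R (x - xp)"] by (simp add: y algebra_simps)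
  finally show ?thesis using M w by simp
qed

section \<open>Kurdyka-Lojasiewicz inequality at points of differentiability\<close>

lemma gderiv_in_limiting_subdiff:
  assumes "GDERIV f x :> D"
  shows "D \<in> limiting_subdiff f x"
proof -
  have "D \<in> frechet_subdiff f x"
  \<comment> \<open>The space may be trivial; then the punctured neighbourhood filter is
    \<open>bot\<close>, and \<open>lim_imp_Liminf\<close> does not apply.\<close>
  proof (cases "at x = bot")
    case True
    then show ?thesis by (simp add: frechet_subdiff_def)
  next
    case False
    have "((\<lambda>y. (f y - f x - inner (y - x) D) / norm (y - x)) \<longlongrightarrow> 0) (at x)"
      using assms unfolding gderiv_def has_derivative_at_within by (auto simp: divide_inverse mult.commute)
    then have "((\<lambda>y. ereal ((f y - f x - inner D (y - x)) / norm (y - x))) \<longlongrightarrow> ereal 0) (at x)"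
      by (simp only: inner_commute tendsto_ereal)
    from lim_imp_Liminf[OF False this] show ?thesis by (simp add: frechet_subdiff_def zero_ereal_def)
  qed
  then show ?thesis unfolding limiting_subdiff_def
    by (intro CollectI exI[of _ "\<lambda>_::nat. x"] exI[of _ "\<lambda>_::nat. D"]) auto
qed

text \<open>The gradient belongs to the limiting subdifferential, so its norm dominates the distance
  from 0. Multiplication by \<open>r powr \<theta>\<close> then turns the inequality into an upper
  bound of the excess.\<close>

lemma KL_property_gderiv:
  assumes KL: "KL_property f xbar \<rho> \<eta> \<theta> \<mu>" and D: "GDERIV f x :> D"
    and x: "norm (x - xbar) \<le> \<rho>" "f xbar < f x" "ereal (f x) < ereal (f xbar) + \<eta>"
  shows "(f x - f xbar) powr \<theta> \<le> \<mu> * (1 - \<theta>) * norm D"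
proof -
  define r where "r = f x - f xbar"
  have r: "r > 0" and th: "\<theta> < 1" "\<mu> > 0" using x KL by (auto simp: r_def KL_property_def)
  have dr: "deriv (\<lambda>s. \<mu> * s powr (1 - \<theta>)) r = \<mu> * (1 - \<theta>) * r powr (- \<theta>)"
    using r by (intro DERIV_imp_deriv) (auto intro!: derivative_eq_intros)
  have "\<forall>x. norm (x - xbar) \<le> \<rho> \<and> f xbar < f x \<and> ereal (f x) < ereal (f xbar) + \<eta> \<longrightarrow>
      1 \<le> ereal (deriv (\<lambda>s. \<mu> * s powr (1 - \<theta>)) (f x - f xbar)) * dist_zero (limiting_subdiff f x)"
    using KL unfolding KL_property_def by (elim conjE)
  from this[rule_format, of x, OF conjI[OF x(1) conjI[OF x(2,3)]]]
  have "1 \<le> ereal (\<mu> * (1 - \<theta>) * r powr (- \<theta>)) * dist_zero (limiting_subdiff f x)"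
    unfolding r_def[symmetric] dr .
  also have "\<dots> \<le> ereal (\<mu> * (1 - \<theta>) * r powr (- \<theta>)) * ereal (norm D)"
    using th gderiv_in_limiting_subdiff[OF D]
    by (intro ereal_mult_left_mono) (auto simp: dist_zero_def intro: INF_lower)
  finally have "1 \<le> \<mu> * (1 - \<theta>) * r powr (- \<theta>) * norm D" by simp
  then have "r powr \<theta> * 1 \<le> r powr \<theta> * (\<mu> * (1 - \<theta>) * r powr (- \<theta>) * norm D)"
    by (intro mult_left_mono) auto
  also have "\<dots> = \<mu> * (1 - \<theta>) * norm D"
    using r by (simp add: powr_minus field_simps)
  finally show ?thesis by (simp add: r_def)
qed

section \<open>Recursive inequalities and rates\<close>

text \<open>The arithmetic-geometric mean inequality, weighted so that only an eighth of
  \<open>u\<close> remains: \<open>u\<close> will be a sum of earlier step sizes, which a later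
  estimate must absorb.\<close>

lemma young_sqrt:
  fixes x u v :: real
  assumes "x \<ge> 0" "u \<ge> 0" "v \<ge> 0" "x\<^sup>2 \<le> u * v"
  shows "x \<le> u / 8 + 2 * v"
proof (rule power2_le_imp_le)
  have "(u / 8 + 2 * v)\<^sup>2 = (u / 8 - 2 * v)\<^sup>2 + u * v" by (simp add: power2_eq_square algebra_simps)
  then show "x\<^sup>2 \<le> (u / 8 + 2 * v)\<^sup>2" using assms(4) by (simp add: add_increasing)
qed (use assms in auto)

text \<open>The tangent inequality of the concave function \<open>s powr (1 - \<theta>)\<close> at
  \<open>r\<close>, multiplied by \<open>r powr \<theta>\<close>.\<close>

lemma powr_concave_diff:
  fixes r t \<theta> :: real
  assumes r: "0 < r" "0 < t" "t \<le> r" and th: "0 < \<theta>" "\<theta> < 1"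
  shows "(1 - \<theta>) * (r - t) \<le> r powr \<theta> * (r powr (1 - \<theta>) - t powr (1 - \<theta>))"
proof (cases "t = r")
  case False
  then have tr: "t < r" using r by simp
  have "\<exists>z. z > t \<and> z < r \<and> r powr (1 - \<theta>) - t powr (1 - \<theta>) = (r - t) * ((1 - \<theta>) * z powr (- \<theta>))"
    by (rule MVT2[OF tr]) (use r in \<open>auto intro!: derivative_eq_intros\<close>)
  then obtain z where z: "t < z" "z < r"
    "r powr (1 - \<theta>) - t powr (1 - \<theta>) = (r - t) * ((1 - \<theta>) * z powr (- \<theta>))" by blast
  have "r powr \<theta> * z powr (- \<theta>) \<ge> 1"
    using z r th by (simp add: powr_minus field_simps powr_mono2)
  then have "(1 - \<theta>) * (r - t) * 1 \<le> (1 - \<theta>) * (r - t) * (r powr \<theta> * z powr (- \<theta>))"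
    using tr th by (intro mult_left_mono) auto
  then show ?thesis unfolding z(3) by (simp add: algebra_simps)
qed simp

text \<open>Solved for \<open>P (k + 2)\<close>, the recursion contracts with factor
  \<open>B / (1 + B)\<close> over two indices, up to a geometric error. The induction therefore has
  two base cases.\<close>

lemma linear_rate_two_step:
  fixes P :: "nat \<Rightarrow> real"
  assumes P0: "\<And>k. k \<ge> N \<Longrightarrow> P k \<ge> 0"
    and rec: "\<And>k. k \<ge> N \<Longrightarrow> P (k + 2) \<le> B * (P k - P (k + 2)) + M * \<beta> ^ k"
    and B: "B \<ge> 0" and M: "M \<ge> 0" and beta: "0 < \<beta>" "\<beta> < 1"
  shows "\<exists>C>0. \<exists>\<alpha>. 0 < \<alpha> \<and> \<alpha> < 1 \<and> (\<forall>k\<ge>N. P k \<le> C * \<alpha> ^ k)"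
proof -
  define \<tau> where "\<tau> = B / (1 + B)"
  have tau: "0 \<le> \<tau>" "\<tau> < 1" using B by (auto simp: \<tau>_def)
  \<comment> \<open>The square of \<alpha> must exceed \<tau> strictly, to leave room for the error,
    and \<alpha> must decay no faster than the error does.\<close>
  define \<alpha> where "\<alpha> = max (sqrt ((1 + \<tau>) / 2)) \<beta>"
  have al: "0 < \<alpha>" "\<alpha> < 1" "\<beta> \<le> \<alpha>" using tau beta by (auto simp: \<alpha>_def)
  have "(sqrt ((1 + \<tau>) / 2))\<^sup>2 \<le> \<alpha>\<^sup>2" by (rule power_mono) (use tau in \<open>auto simp: \<alpha>_def\<close>)
  then have al2: "\<tau> < \<alpha>\<^sup>2" using tau by simp
  \<comment> \<open>The first quotient lets \<open>Q\<close> absorb the error in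
    \<open>\<tau> * Q + M \<le> Q * \<alpha>\<^sup>2\<close>; the other two cover the base
    cases.\<close>
  define Q where "Q = max 1 (max (M / (\<alpha>\<^sup>2 - \<tau>)) (max (P N / \<alpha> ^ N) (P (Suc N) / \<alpha> ^ Suc N)))"
  have "P k \<le> Q * \<alpha> ^ k" if "k \<ge> N" for k
    using that
  proof (induction k rule: less_induct)
    case (less k)
    consider "k = N" | "k = Suc N" | j where "k = j + 2" "j \<ge> N"
    proof -
      have "k = N \<or> k = Suc N \<or> (k = (k - 2) + 2 \<and> k - 2 \<ge> N)"
        using less.prems by linarith
      then show ?thesis using that by blast
    qed
    then show ?case
    proof cases
      case 1
      have "P N / \<alpha> ^ N \<le> Q" by (simp add: Q_def)
      then show ?thesis using 1 al by (simp add: field_simps)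
    next
      case 2
      have "P (Suc N) / \<alpha> ^ Suc N \<le> Q" by (simp add: Q_def)
      then show ?thesis using 2 al by (simp add: field_simps)
    next
      case (3 j)
      have "(1 + B) * P (j + 2) \<le> B * P j + M * \<beta> ^ j" using rec[OF 3(2)] by (simp add: algebra_simps)
      then have "P (j + 2) \<le> (B * P j + M * \<beta> ^ j) / (1 + B)"
        using B by (simp add: pos_le_divide_eq mult.commute)
      also have "\<dots> = \<tau> * P j + M * \<beta> ^ j / (1 + B)" by (simp add: \<tau>_def add_divide_distrib)
      also have "\<dots> \<le> \<tau> * (Q * \<alpha> ^ j) + M * \<alpha> ^ j"
      proof (rule add_mono)
        show "\<tau> * P j \<le> \<tau> * (Q * \<alpha> ^ j)" using less.IH[of j] 3 tau by (intro mult_left_mono) auto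
        have "M * \<beta> ^ j / (1 + B) \<le> M * \<beta> ^ j / 1"
          using B M beta by (intro divide_left_mono) auto
        also have "\<dots> \<le> M * \<alpha> ^ j" using M beta al by (simp add: mult_left_mono power_mono)
        finally show "M * \<beta> ^ j / (1 + B) \<le> M * \<alpha> ^ j" .
      qed
      also have "\<dots> = (\<tau> * Q + M) * \<alpha> ^ j" by (simp add: algebra_simps)
      also have "\<dots> \<le> (Q * \<alpha>\<^sup>2) * \<alpha> ^ j"
      proof (rule mult_right_mono)
        have "M / (\<alpha>\<^sup>2 - \<tau>) \<le> Q" by (simp add: Q_def)
        then have "M \<le> Q * (\<alpha>\<^sup>2 - \<tau>)" using al2 by (simp add: pos_divide_le_eq)
        then show "\<tau> * Q + M \<le> Q * \<alpha>\<^sup>2" by (simp add: algebra_simps)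
      qed (use al in auto)
      finally show ?thesis using 3 by (simp add: power_add power2_eq_square algebra_simps)
    qed
  qed
  moreover have "Q > 0" unfolding Q_def by simp
  ultimately show ?thesis using al by blast
qed

lemma powr_diff_two_step:
  fixes \<omega> :: real
  assumes w: "\<omega> > 0" and k: "k \<ge> 1"
  shows "real k powr (- \<omega>) - real (k + 2) powr (- \<omega>) \<le> 2 * \<omega> * 3 powr (\<omega> + 1) * real (k + 2) powr (- \<omega> - 1)"
proof -
  have "\<exists>z. z > real k \<and> z < real (k + 2) \<and>
      real (k + 2) powr (- \<omega>) - real k powr (- \<omega>) = (real (k + 2) - real k) * (- \<omega> * z powr (- \<omega> - 1))"
    by (rule MVT2) (use k in \<open>auto intro!: derivative_eq_intros\<close>)
  then obtain z where z: "z > real k"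
     "real k powr (- \<omega>) - real (k + 2) powr (- \<omega>) = 2 * \<omega> * z powr (- \<omega> - 1)" by auto
  \<comment> \<open>For \<open>k \<ge> 1\<close> one has \<open>k \<ge> (k + 2) / 3\<close>, and the
    exponent is negative.\<close>
  have "z powr (- \<omega> - 1) \<le> (real (k + 2) / 3) powr (- \<omega> - 1)"
    using z k w by (intro powr_mono2') auto
  also have "\<dots> = 3 powr (\<omega> + 1) * real (k + 2) powr (- \<omega> - 1)"
    by (subst powr_divide) (auto simp: powr_minus[symmetric] field_simps powr_minus_divide powr_diff powr_add)
  finally show ?thesis unfolding z(2) using w by (simp add: mult.assoc)
qed

text \<open>The exponent \<omega> satisfies \<open>\<omega> / \<nu> = \<omega> + 1\<close>. If the
  claim failed at \<open>j + 2\<close>, the recursion would force a drop of order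
  \<open>(j + 2) powr (- \<omega> - 1)\<close> with a constant growing like
  \<open>Q powr (1 / \<nu>)\<close>, while the induction hypothesis permits only a constant linear
  in \<open>Q\<close>. As \<open>1 / \<nu> > 1\<close>, a large \<open>Q\<close> excludes
  this.\<close>

lemma sublinear_rate_two_step:
  fixes P :: "nat \<Rightarrow> real"
  assumes P0: "\<And>k. k \<ge> N \<Longrightarrow> P k \<ge> 0"
    and mono: "\<And>k. k \<ge> N \<Longrightarrow> P (k + 2) \<le> P k"
    and rec: "\<And>k. k \<ge> N \<Longrightarrow> P (k + 2) \<le> B * (P k - P (k + 2)) powr \<nu> + M * \<beta> ^ k"
    and nu: "0 < \<nu>" "\<nu> < 1" and B: "B \<ge> 0" and M: "M \<ge> 0" and beta: "0 < \<beta>" "\<beta> < 1"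
  shows "\<exists>C>0. \<forall>k\<ge>Suc N. P k \<le> C * real k powr (- (\<nu> / (1 - \<nu>)))"
proof -
  define \<omega> where "\<omega> = \<nu> / (1 - \<nu>)"
  have w: "\<omega> > 0" using nu by (simp add: \<omega>_def)
  have wn: "\<omega> / \<nu> = \<omega> + 1" using nu by (simp add: \<omega>_def field_simps)
  define c where "c = - ln \<beta>"
  have c: "c > 0" using beta by (simp add: c_def)
  \<comment> \<open>A geometric sequence decays faster than any power: raise
    \<open>x \<le> exp x\<close> to the power \<omega> with
    \<open>x = c * (k + 2) / \<omega>\<close>.\<close>
  have S: "\<beta> ^ k \<le> (\<omega> / c) powr \<omega> / \<beta>\<^sup>2 * real (k + 2) powr (- \<omega>)" for k
  proof -
    have "c * real (k + 2) / \<omega> \<le> exp (c * real (k + 2) / \<omega>)"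
      using exp_ge_add_one_self[of "c * real (k + 2) / \<omega>"] by linarith
    then have "(c * real (k + 2) / \<omega>) powr \<omega> \<le> exp (c * real (k + 2) / \<omega>) powr \<omega>"
      using c w by (intro powr_mono2) auto
    also have "\<dots> = exp (c * real (k + 2))" using w by (simp add: exp_powr_real)
    also have "\<dots> = inverse (\<beta> ^ (k + 2))"
      unfolding exp_of_nat2_mult using beta by (simp add: c_def exp_minus power_inverse)
    finally have "(c * real (k + 2) / \<omega>) powr \<omega> * \<beta> ^ (k + 2) \<le> 1"
      using beta by (simp add: field_simps)
    moreover have "(c * real (k + 2) / \<omega>) powr \<omega> = real (k + 2) powr \<omega> / (\<omega> / c) powr \<omega>"
      using c w powr_divide[of "real (k + 2)" "\<omega> / c" \<omega>] by (simp add: mult.commute)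
    ultimately have "real (k + 2) powr \<omega> * \<beta> ^ (k + 2) \<le> (\<omega> / c) powr \<omega>"
      using c w by (simp add: pos_divide_le_eq)
    then show ?thesis
      using beta by (simp add: powr_minus power2_eq_square field_simps)
  qed
  define h where "h = 2 * \<omega> * 3 powr (\<omega> + 1)"
  have h: "h > 0" using w by (simp add: h_def)
  \<comment> \<open>Divisions by \<open>2 * B'\<close> follow, and \<open>B\<close> may be
    0.\<close>
  define B' where "B' = B + 1"
  have B': "B' > 0" using B by (simp add: B'_def)
  define M' where "M' = 2 * M * ((\<omega> / c) powr \<omega> / \<beta>\<^sup>2)"
  define Q where "Q = max 1 (max M' (max ((h * (2 * B') powr (1 / \<nu>)) powr \<omega>)
     (max (P (Suc N) / real (Suc N) powr (- \<omega>)) (P (N + 2) / real (N + 2) powr (- \<omega>)))))"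
  have Q: "Q > 0" unfolding Q_def by simp
  have Qh: "Q * h \<le> (Q / (2 * B')) powr (1 / \<nu>)"
  proof -
    have "(h * (2 * B') powr (1 / \<nu>)) powr \<omega> \<le> Q" by (simp add: Q_def)
    then have "((h * (2 * B') powr (1 / \<nu>)) powr \<omega>) powr (1 / \<omega>) \<le> Q powr (1 / \<omega>)"
      using w by (intro powr_mono2) auto
    then have "h * (2 * B') powr (1 / \<nu>) \<le> Q powr (1 / \<omega>)"
      using w h by (simp add: powr_powr)
    then have "Q * (h * (2 * B') powr (1 / \<nu>)) \<le> Q * Q powr (1 / \<omega>)"
      using Q by (intro mult_left_mono) auto
    also have "\<dots> = Q powr (1 / \<nu>)"
    proof -
      have "1 / \<nu> = 1 + 1 / \<omega>" using nu by (simp add: \<omega>_def field_simps)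
      then show ?thesis using Q by (simp add: powr_add)
    qed
    finally show ?thesis using B' Q by (simp add: powr_divide field_simps)
  qed
  \<comment> \<open>Starting at \<open>Suc N\<close> keeps the index positive; at index 0 the
    right-hand side would be 0, since \<open>0 powr x = 0\<close>.\<close>
  have "P k \<le> Q * real k powr (- \<omega>)" if "k \<ge> Suc N" for k
    using that
  proof (induction k rule: less_induct)
    case (less k)
    consider "k = Suc N" | "k = N + 2" | j where "k = j + 2" "j \<ge> Suc N"
    proof -
      have "k = Suc N \<or> k = N + 2 \<or> (k = (k - 2) + 2 \<and> k - 2 \<ge> Suc N)"
        using less.prems by linarith
      then show ?thesis using that by blast
    qed
    then show ?case
    proof cases
      case 1
      have "P (Suc N) / real (Suc N) powr (- \<omega>) \<le> Q" by (simp add: Q_def)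
      then show ?thesis using 1 by (simp add: pos_divide_le_eq)
    next
      case 2
      have "P (N + 2) / real (N + 2) powr (- \<omega>) \<le> Q" by (simp add: Q_def)
      then show ?thesis using 2 by (simp add: pos_divide_le_eq)
    next
      case (3 j)
      define d where "d = P j - P (j + 2)"
      define x where "x = real (j + 2)"
      have x: "x > 0" by (simp add: x_def)
      have d: "d \<ge> 0" using mono 3 by (simp add: d_def)
      have "P (j + 2) \<le> B * d powr \<nu> + M * \<beta> ^ j" using rec[of j] 3 by (simp add: d_def)
      also have "\<dots> \<le> B' * d powr \<nu> + M * \<beta> ^ j" by (simp add: B'_def algebra_simps)
      finally have le: "P (j + 2) \<le> B' * d powr \<nu> + M * \<beta> ^ j" .
      have "P (j + 2) \<le> Q * x powr (- \<omega>)"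
      \<comment> \<open>Whichever of the two terms is larger bounds their sum up to a factor 2; this
        is the 2 in \<open>M'\<close> and in \<open>2 * B'\<close>.\<close>
      proof (cases "B' * d powr \<nu> \<le> M * \<beta> ^ j")
        case True
        then have "P (j + 2) \<le> 2 * M * \<beta> ^ j" using le by simp
        also have "\<dots> \<le> M' * x powr (- \<omega>)"
          using mult_left_mono[OF S[of j], of "2 * M"] M by (simp add: M'_def x_def mult.assoc)
        also have "\<dots> \<le> Q * x powr (- \<omega>)" by (intro mult_right_mono) (auto simp: Q_def)
        finally show ?thesis .
      next
        case False
        show ?thesis
        proof (rule ccontr)
          assume n: "\<not> P (j + 2) \<le> Q * x powr (- \<omega>)"
          then have "Q * x powr (- \<omega>) < 2 * B' * d powr \<nu>" using le False by linarith
          then have "Q / (2 * B') * x powr (- \<omega>) < d powr \<nu>"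
            using B' by (simp add: field_simps)
          then have "(Q / (2 * B') * x powr (- \<omega>)) powr (1 / \<nu>) < (d powr \<nu>) powr (1 / \<nu>)"
            using Q B' nu by (intro powr_less_mono2) auto
          also have "(d powr \<nu>) powr (1 / \<nu>) = d" using nu d by (simp add: powr_powr)
          also have "(Q / (2 * B') * x powr (- \<omega>)) powr (1 / \<nu>)
              = (Q / (2 * B')) powr (1 / \<nu>) * (x powr (- \<omega>)) powr (1 / \<nu>)"
            by (rule powr_mult)
          also have "(x powr (- \<omega>)) powr (1 / \<nu>) = x powr (- \<omega> - 1)"
            unfolding powr_powr using wn by (intro arg_cong[where f = "\<lambda>z. x powr z"]) simp
          finally have "(Q / (2 * B')) powr (1 / \<nu>) * x powr (- \<omega> - 1) < d" .
          moreover have "d < Q * real j powr (- \<omega>) - Q * x powr (- \<omega>)"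
            using n less.IH[of j] 3 by (simp add: d_def)
          moreover have "Q * (real j powr (- \<omega>) - x powr (- \<omega>)) \<le> Q * (h * x powr (- \<omega> - 1))"
            using powr_diff_two_step[OF w, of j] 3 Q by (intro mult_left_mono) (auto simp: h_def x_def)
          moreover have "Q * h * x powr (- \<omega> - 1) \<le> (Q / (2 * B')) powr (1 / \<nu>) * x powr (- \<omega> - 1)"
            using Qh by (intro mult_right_mono) auto
          ultimately show False by (simp add: algebra_simps)
        qed
      qed
      then show ?thesis using 3 by (simp add: x_def)
    qed
  qed
  then show ?thesis using Q unfolding \<omega>_def by blast
qed

section \<open>Descent sequences with the Kurdyka-Lojasiewicz inequality\<close>

text \<open>A potential that contains the tail sum \<open>x / (1 - y)\<close> of a geometric series
  pays the current error \<open>x\<close> when it moves on by one index.\<close>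

lemma geometric_tail_diff:
  fixes x y :: real
  assumes "y < 1"
  shows "x / (1 - y) - x * y / (1 - y) = x"
proof -
  have "x / (1 - y) - x * y / (1 - y) = x * (1 - y) / (1 - y)"
    by (simp add: diff_divide_distrib right_diff_distrib)
  then show ?thesis using assms by simp
qed

text \<open>Taking roots gives \<open>s'' \<le> s' / 2 + sqrt (r - t) + e\<close>. Concavity and the
  bound on \<open>r powr \<theta>\<close> give \<open>r - t \<le> (s + s') * Y\<close>, and
  \<open>young_sqrt\<close> splits the root of this product; \<open>5 / 8\<close> is
  \<open>1 / 2 + 1 / 8\<close>.\<close>

lemma KL_step_size_bound:
  fixes s s' s'' r t e \<theta> C :: real
  assumes s: "s \<ge> 0" "s' \<ge> 0" "s'' \<ge> 0" and r: "0 < t" "t \<le> r" and th: "0 < \<theta>" "\<theta> < 1"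
    and dec: "s''\<^sup>2 \<le> s'\<^sup>2 / 4 + (r - t) + e\<^sup>2" and e: "e \<ge> 0" and C: "C \<ge> 0"
    and KL: "r powr \<theta> \<le> C * (s + s')"
  shows "s'' \<le> 5 / 8 * s' + 1 / 8 * s + 2 * C / (1 - \<theta>) * (r powr (1 - \<theta>) - t powr (1 - \<theta>)) + e"
proof -
  define \<phi> where "\<phi> = r powr (1 - \<theta>) - t powr (1 - \<theta>)"
  have phi: "\<phi> \<ge> 0" using r th by (simp add: \<phi>_def powr_mono2)
  have "(1 - \<theta>) * (r - t) \<le> r powr \<theta> * \<phi>"
    unfolding \<phi>_def by (rule powr_concave_diff) (use r th in auto)
  also have "\<dots> \<le> C * (s + s') * \<phi>" using KL phi by (rule mult_right_mono)
  finally have "(sqrt (r - t))\<^sup>2 \<le> (s + s') * (C / (1 - \<theta>) * \<phi>)"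
    using th r by (simp add: field_simps)
  moreover define Y where "Y = C / (1 - \<theta>) * \<phi>"
  ultimately have "sqrt (r - t) \<le> (s + s') / 8 + 2 * Y"
    by (intro young_sqrt) (use s phi C th r in auto)
  moreover have "s'' \<le> s' / 2 + sqrt (r - t) + e"
  proof (rule power2_le_imp_le)
    have "s''\<^sup>2 \<le> (s' / 2)\<^sup>2 + (sqrt (r - t))\<^sup>2 + e\<^sup>2" using dec r by (simp add: power_divide)
    also have "\<dots> \<le> (s' / 2 + sqrt (r - t) + e)\<^sup>2"
      using s e r by (simp add: power2_sum)
    finally show "s''\<^sup>2 \<le> (s' / 2 + sqrt (r - t) + e)\<^sup>2" .
  qed (use s r e in auto)
  ultimately have "s'' \<le> 5 / 8 * s' + 1 / 8 * s + 2 * Y + e"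
    by (simp add: add_divide_distrib)
  then show ?thesis by (simp add: Y_def \<phi>_def)
qed

text \<open>Here \<open>s k\<close> measures the step from \<open>W k\<close> to \<open>W (k + 1)\<close>, \<open>r k\<close> is the excess of the objective
  at \<open>W k\<close> over its value at the limit point, and \<open>(M * \<beta> ^ k)\<^sup>2\<close> pays for the change of the
  objective from one iteration to the next.\<close>

locale KL_descent =
  fixes W :: "nat \<Rightarrow> 'a::real_normed_vector" and Wbar :: 'a and s r :: "nat \<Rightarrow> real"
    and K :: nat and c C M \<beta> \<theta> \<rho> :: real
  assumes rho: "\<rho> > 0" and th: "0 < \<theta>" "\<theta> < 1" and beta: "0 < \<beta>" "\<beta> < 1"
    and c: "c > 0" and C: "C \<ge> 0" and M: "M \<ge> 0"
    and s: "\<And>k. s k \<ge> 0"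
    and step: "\<And>k. k \<ge> K \<Longrightarrow> norm (W (Suc k) - W k) \<le> c * s k"
    and r_pos: "\<And>k. k \<ge> K \<Longrightarrow> r k > 0"
    and r_dec: "\<And>k. k \<ge> K \<Longrightarrow> r (Suc k) \<le> r k"
    and r_lim: "r \<longlonglongrightarrow> 0"
    and dec: "\<And>k. k \<ge> K \<Longrightarrow>
      (s (Suc k))\<^sup>2 \<le> (s k)\<^sup>2 / 4 + (r (Suc k) - r (Suc (Suc k))) + (M * \<beta> ^ k)\<^sup>2"
    and KL: "\<And>k. k \<ge> K \<Longrightarrow> norm (W (k + 1) - Wbar) \<le> \<rho> \<Longrightarrow> norm (W (k + 2) - Wbar) \<le> \<rho> \<Longrightarrow>
      r (k + 2) powr \<theta> \<le> C * (s k + s (k + 1))"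
    and limit_point: "\<exists>f. strict_mono f \<and> (\<lambda>j. W (f j)) \<longlonglongrightarrow> Wbar"
begin

text \<open>The Lyapunov function \<open>X\<close> is nonnegative and drops by at least three
  quarters of the squared step, so the steps vanish wherever the iterates are. The trapping argument
  relies on this.\<close>

lemma s_lim: "s \<longlonglongrightarrow> 0"
proof -
  define X where "X k = (s k)\<^sup>2 / 4 + r (Suc k) + M\<^sup>2 * (\<beta>\<^sup>2) ^ k / (1 - \<beta>\<^sup>2)" for k
  have b2: "\<beta>\<^sup>2 < 1" using beta by (simp add: power_less_one_iff)
  have drop: "3 / 4 * (s (Suc k))\<^sup>2 \<le> X k - X (Suc k)" if "k \<ge> K" for k
  proof -
    have "M\<^sup>2 * (\<beta>\<^sup>2) ^ k / (1 - \<beta>\<^sup>2) - M\<^sup>2 * (\<beta>\<^sup>2) ^ Suc k / (1 - \<beta>\<^sup>2) = (M * \<beta> ^ k)\<^sup>2"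
      using geometric_tail_diff[OF b2, of "M\<^sup>2 * (\<beta>\<^sup>2) ^ k"]
      by (simp add: power_mult_distrib mult_ac flip: power_mult)
    then show ?thesis using dec[OF that] unfolding X_def by linarith
  qed
  have X0: "0 \<le> X k" if "k \<ge> K" for k
    using r_pos[of "Suc k"] that b2 by (simp add: X_def)
  have "decseq (\<lambda>k. X (k + K))"
  proof (rule decseq_SucI)
    fix k
    have "0 \<le> 3 / 4 * (s (Suc (k + K)))\<^sup>2" by simp
    then show "X (Suc k + K) \<le> X (k + K)" using drop[of "k + K"]
      by (simp only: add_Suc) linarith
  qed
  then obtain x where "(\<lambda>k. X (k + K)) \<longlonglongrightarrow> x"
    by (rule decseq_convergent[of _ 0]) (use X0 in auto)
  then have "X \<longlonglongrightarrow> x" by (rule LIMSEQ_offset)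
  then have "(\<lambda>k. X k - X (Suc k)) \<longlonglongrightarrow> x - x" by (intro tendsto_diff LIMSEQ_Suc)
  then have "(\<lambda>k. 4 / 3 * (X k - X (Suc k))) \<longlonglongrightarrow> 0"
    by (intro tendsto_mult_right_zero) simp
  then have "(\<lambda>k. (s (Suc k))\<^sup>2) \<longlonglongrightarrow> 0"
  proof (rule tendsto_sandwich[rotated 3])
    show "\<forall>\<^sub>F k in sequentially. (s (Suc k))\<^sup>2 \<le> 4 / 3 * (X k - X (Suc k))"
      using drop by (intro eventually_sequentiallyI[of K]) fastforce
  qed auto
  then have "(\<lambda>k. sqrt ((s (Suc k))\<^sup>2)) \<longlonglongrightarrow> sqrt 0" by (rule tendsto_real_sqrt)
  then show ?thesis using s by (simp add: filterlim_sequentially_Suc)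
qed

text \<open>The weights of the two step sizes make the estimate \<open>KL_step_size_bound\<close> telescope, so that
  \<open>P k\<close> bounds the remaining length of the path, and the distance to the limit with it.\<close>

definition P :: "nat \<Rightarrow> real" where
  "P k = 3 / 4 * s (k + 1) + 1 / 8 * s k + 2 * C / (1 - \<theta>) * r (k + 2) powr (1 - \<theta>)
     + M * \<beta> ^ (k + 1) / (1 - \<beta>)"

lemma P_nonneg: "P k \<ge> 0"
  using s C th M beta by (simp add: P_def)

lemma P_lim: "P \<longlonglongrightarrow> 0"
proof -
  have "(\<lambda>k. r (k + 2) powr (1 - \<theta>)) \<longlonglongrightarrow> 0"
  proof (rule tendsto_zero_powrI[where b = "1 - \<theta>"])
    show "(\<lambda>k. r (k + 2)) \<longlonglongrightarrow> 0" using r_lim by (rule LIMSEQ_ignore_initial_segment)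
    show "\<forall>\<^sub>F k in sequentially. 0 \<le> r (k + 2)"
      using r_pos by (intro eventually_sequentiallyI[of K]) (simp add: less_imp_le)
  qed (use th in auto)
  moreover have "(\<lambda>k. \<beta> ^ (k + 1)) \<longlonglongrightarrow> 0"
    by (rule LIMSEQ_ignore_initial_segment[OF LIMSEQ_realpow_zero]) (use beta in auto)
  moreover have "(\<lambda>k. s (k + 1)) \<longlonglongrightarrow> 0" using s_lim by (rule LIMSEQ_ignore_initial_segment)
  ultimately have "(\<lambda>k. 3 / 4 * s (k + 1) + 1 / 8 * s k + 2 * C / (1 - \<theta>) * r (k + 2) powr (1 - \<theta>)
     + M / (1 - \<beta>) * \<beta> ^ (k + 1)) \<longlonglongrightarrow> 3 / 4 * 0 + 1 / 8 * 0 + 2 * C / (1 - \<theta>) * 0 + M / (1 - \<beta>) * 0"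
    by (intro tendsto_intros s_lim)
  then show ?thesis unfolding P_def by simp
qed

text \<open>The step terms of \<open>P k - P (k + 1)\<close> are
  \<open>5 / 8 * s (k + 1) + 1 / 8 * s k - 3 / 4 * s (k + 2)\<close>. With the other differences
  this is the bound of \<open>KL_step_size_bound\<close> minus \<open>3 / 4 * s (k + 2)\<close>,
  which leaves a quarter of the step.\<close>

lemma P_drop:
  assumes "k \<ge> K" "norm (W (k + 1) - Wbar) \<le> \<rho>" "norm (W (k + 2) - Wbar) \<le> \<rho>"
  shows "s (k + 2) / 4 \<le> P k - P (k + 1)"
proof -
  have "s (k + 2) \<le> 5 / 8 * s (k + 1) + 1 / 8 * s k
      + 2 * C / (1 - \<theta>) * (r (k + 2) powr (1 - \<theta>) - r (k + 3) powr (1 - \<theta>)) + M * \<beta> ^ (k + 1)"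
  proof (rule KL_step_size_bound)
    show "(s (k + 2))\<^sup>2 \<le> (s (k + 1))\<^sup>2 / 4 + (r (k + 2) - r (k + 3)) + (M * \<beta> ^ (k + 1))\<^sup>2"
      using dec[of "k + 1"] assms(1) by (simp add: numeral_3_eq_3 numeral_2_eq_2)
    show "0 < r (k + 3)" using r_pos assms(1) by simp
    show "r (k + 3) \<le> r (k + 2)" using r_dec[of "k + 2"] assms(1) by (simp add: numeral_3_eq_3)
    show "r (k + 2) powr \<theta> \<le> C * (s k + s (k + 1))" using KL assms by simp
  qed (use s th beta M C in auto)
  moreover have "M * \<beta> ^ (k + 1) / (1 - \<beta>) - M * \<beta> ^ (k + 2) / (1 - \<beta>) = M * \<beta> ^ (k + 1)"
    using geometric_tail_diff[of \<beta> "M * \<beta> ^ (k + 1)"] beta by (simp add: mult_ac)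
  ultimately show ?thesis unfolding P_def
    by (simp add: algebra_simps numeral_3_eq_3 numeral_2_eq_2)
qed

text \<open>Each step costs at most \<open>4 * c\<close> times a drop of \<open>P\<close>, so the
  whole path from \<open>W (N + 2)\<close> is no longer than \<open>4 * c * P N\<close>. Ball
  membership and path length must be proved together, since \<open>P_drop\<close> needs two
  consecutive iterates in the ball.\<close>

lemma trapped_step:
  assumes N: "N \<ge> K" "norm (W (N + 1) - Wbar) \<le> \<rho>" "norm (W (N + 2) - Wbar) + 4 * c * P N \<le> \<rho>"
  shows "norm (W (N + n + 1) - Wbar) \<le> \<rho> \<and> norm (W (N + n + 2) - Wbar) \<le> \<rho> \<and>
     norm (W (N + n + 2) - W (N + 2)) \<le> 4 * c * (P N - P (N + n))"
proof (induction n)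
  case 0
  have "4 * c * P N \<ge> 0" using c P_nonneg by simp
  then show ?case using N by simp
next
  case (Suc n)
  let ?k = "N + n"
  have "norm (W (?k + 3) - W (?k + 2)) \<le> c * s (?k + 2)"
    using step[of "?k + 2"] N(1) by (simp add: numeral_3_eq_3)
  also have "\<dots> \<le> c * (4 * (P ?k - P (?k + 1)))"
    using P_drop[of ?k] Suc N(1) c by (intro mult_left_mono) auto
  finally have "norm (W (?k + 3) - W (N + 2)) \<le> 4 * c * (P N - P (?k + 1))"
    using Suc norm_triangle_ineq[of "W (?k + 3) - W (?k + 2)" "W (?k + 2) - W (N + 2)"]
    by (simp add: algebra_simps)
  moreover have "4 * c * P (?k + 1) \<ge> 0" using c P_nonneg by simp
  moreover have "norm (W (?k + 3) - Wbar) \<le> norm (W (?k + 3) - W (N + 2)) + norm (W (N + 2) - Wbar)"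
    using norm_triangle_ineq[of "W (?k + 3) - W (N + 2)" "W (N + 2) - Wbar"] by simp
  ultimately show ?case using Suc N(3) by (simp add: algebra_simps numeral_3_eq_3)
qed

text \<open>The subsequence comes close to the limit point at an index so late that the step and the
  path budget \<open>4 * c * P N\<close> are small as well.\<close>

lemma eventually_trapped:
  "\<exists>N\<ge>K. \<forall>k\<ge>N. norm (W (k + 1) - Wbar) \<le> \<rho> \<and> norm (W (k + 2) - Wbar) \<le> \<rho>"
proof -
  have "(\<lambda>k. c * s (k + 1)) \<longlonglongrightarrow> c * 0" "(\<lambda>k. 4 * c * P k) \<longlonglongrightarrow> 4 * c * 0"
    by (intro tendsto_intros LIMSEQ_ignore_initial_segment s_lim P_lim)+
  then have "\<forall>\<^sub>F k in sequentially. c * s (k + 1) < \<rho> / 4" "\<forall>\<^sub>F k in sequentially. 4 * c * P k < \<rho> / 4"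
    using rho by (auto dest!: order_tendstoD(2)[where a = "\<rho> / 4"])
  then have "\<forall>\<^sub>F k in sequentially. c * s (k + 1) < \<rho> / 4 \<and> 4 * c * P k < \<rho> / 4 \<and> k \<ge> K"
    using eventually_ge_at_top[of K] by eventually_elim auto
  then obtain N0 where N0: "\<And>k. k \<ge> N0 \<Longrightarrow> c * s (k + 1) < \<rho> / 4 \<and> 4 * c * P k < \<rho> / 4 \<and> k \<ge> K"
    unfolding eventually_sequentially by blast
  obtain f where f: "strict_mono f" "(\<lambda>j. W (f j)) \<longlonglongrightarrow> Wbar" using limit_point by blast
  have "\<forall>\<^sub>F j in sequentially. norm (W (f j) - Wbar) < \<rho> / 4"
    using tendstoD[OF f(2), of "\<rho> / 4"] rho by (simp add: dist_norm)
  then have "\<forall>\<^sub>F j in sequentially. norm (W (f j) - Wbar) < \<rho> / 4 \<and> j \<ge> N0 + 2"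
    using eventually_ge_at_top by (rule eventually_conj)
  then obtain j where j: "norm (W (f j) - Wbar) < \<rho> / 4" "j \<ge> N0 + 2"
    using eventually_happens'[OF sequentially_bot] by blast
  \<comment> \<open>The close iterate is to be \<open>W (N + 2)\<close>;
    \<open>f j \<ge> N0 + 2\<close> prevents truncation.\<close>
  define N where "N = f j - 2"
  have "f j \<ge> N0 + 2" using j(2) seq_suble[OF f(1), of j] by linarith
  then have N: "f j = N + 2" "N \<ge> N0" by (auto simp: N_def)
  have "norm (W (N + 2) - W (N + 1)) \<le> c * s (N + 1)"
    using step[of "N + 1"] N0[OF N(2)] by simp
  moreover have "norm (W (N + 1) - Wbar) \<le> norm (W (N + 2) - W (N + 1)) + norm (W (N + 2) - Wbar)"
    using norm_triangle_ineq4[of "W (N + 2) - Wbar" "W (N + 2) - W (N + 1)"] by simp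
  ultimately have N1: "norm (W (N + 1) - Wbar) \<le> \<rho>" "norm (W (N + 2) - Wbar) + 4 * c * P N \<le> \<rho>" "N \<ge> K"
    using N0[OF N(2)] j(1) rho unfolding N(1) by auto
  show ?thesis
    using trapped_step[OF N1(3,1,2)] N1(3) by (metis le_iff_add)
qed

text \<open>Once the iterates are trapped, the path after \<open>W (k + 2)\<close> has length at
  most \<open>4 * c * P k\<close>. Letting the end point run along the subsequence makes this a
  bound of the distance to the limit point.\<close>

lemma eventually_error_bound:
  "\<exists>N\<ge>K. \<forall>k\<ge>N. norm (W (k + 2) - Wbar) \<le> 4 * c * P k \<and> s (k + 2) / 4 \<le> P k - P (k + 1) \<and>
     r (k + 2) powr \<theta> \<le> C * (s k + s (k + 1))"
proof -
  obtain N where N: "N \<ge> K"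
    "\<And>k. k \<ge> N \<Longrightarrow> norm (W (k + 1) - Wbar) \<le> \<rho> \<and> norm (W (k + 2) - Wbar) \<le> \<rho>"
    using eventually_trapped by blast
  have drop: "s (k + 2) / 4 \<le> P k - P (k + 1)" if "k \<ge> N" for k
    using P_drop N that by simp
  have tail: "norm (W (k + n + 2) - W (k + 2)) \<le> 4 * c * (P k - P (k + n))" if k: "k \<ge> N" for k n
  proof (induction n)
    case (Suc n)
    have "norm (W (k + n + 3) - W (k + n + 2)) \<le> c * s (k + n + 2)"
      using step[of "k + n + 2"] N(1) k by (simp add: numeral_3_eq_3)
    also have "\<dots> \<le> c * (4 * (P (k + n) - P (k + n + 1)))"
      using drop[of "k + n"] k c by (intro mult_left_mono) auto
    finally show ?case
      using Suc norm_triangle_ineq[of "W (k + n + 3) - W (k + n + 2)" "W (k + n + 2) - W (k + 2)"]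
      by (simp add: algebra_simps numeral_3_eq_3)
  qed simp
  obtain f where f: "strict_mono f" "(\<lambda>j. W (f j)) \<longlonglongrightarrow> Wbar" using limit_point by blast
  have "norm (W (k + 2) - Wbar) \<le> 4 * c * P k" if k: "k \<ge> N" for k
  proof -
    have "norm (Wbar - W (k + 2)) \<le> 4 * c * P k"
    proof (rule LIMSEQ_le_const2)
      show "(\<lambda>j. norm (W (f j) - W (k + 2))) \<longlonglongrightarrow> norm (Wbar - W (k + 2))"
        by (intro tendsto_intros f(2))
      show "\<exists>J. \<forall>j\<ge>J. norm (W (f j) - W (k + 2)) \<le> 4 * c * P k"
      proof (intro exI allI impI)
        fix j assume "j \<ge> k + 2"
        then have "f j \<ge> k + 2" using seq_suble[OF f(1), of j] by linarith
        then obtain n where n: "f j = k + n + 2" by (metis add.commute add.left_commute le_iff_add)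
        have "4 * c * P (k + n) \<ge> 0" using c P_nonneg by simp
        then show "norm (W (f j) - W (k + 2)) \<le> 4 * c * P k"
          using tail[OF k, of n] unfolding n by (simp add: algebra_simps)
      qed
    qed
    then show ?thesis by (simp add: norm_minus_commute)
  qed
  then show ?thesis using N drop KL by (intro exI[of _ N]) auto
qed

text \<open>In \<open>P (k + 2)\<close>, the step terms are bounded by the two-step drop
  \<open>D k\<close>, and the excess term by \<open>D k powr \<nu>\<close>, via the inequality
  raised to the power \<open>\<nu> = (1 - \<theta>) / \<theta>\<close>. Since
  \<open>D k \<le> 1\<close>, the smaller of the exponents 1 and \<nu> governs: it is 1 exactly if
  \<open>\<theta> \<le> 1 / 2\<close>.\<close>

theorem rates:
  shows "\<theta> \<le> 1 / 2 \<Longrightarrow>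
      \<exists>C>0. \<exists>\<alpha>. 0 < \<alpha> \<and> \<alpha> < 1 \<and> (\<forall>\<^sub>F k in sequentially. norm (W k - Wbar) \<le> C * \<alpha> ^ k)" (is "_ \<Longrightarrow> ?lin")
    and "1 / 2 < \<theta> \<Longrightarrow>
      \<exists>C>0. \<forall>\<^sub>F k in sequentially. norm (W k - Wbar) \<le> C * real k powr (- (1 - \<theta>) / (2 * \<theta> - 1))" (is "_ \<Longrightarrow> ?sub")
proof -
  define \<nu> where "\<nu> = (1 - \<theta>) / \<theta>"
  have nu: "\<nu> > 0" using th by (simp add: \<nu>_def)
  obtain N1 where N1: "N1 \<ge> K"
    "\<And>k. k \<ge> N1 \<Longrightarrow> norm (W (k + 2) - Wbar) \<le> 4 * c * P k"
    "\<And>k. k \<ge> N1 \<Longrightarrow> s (k + 2) / 4 \<le> P k - P (k + 1)"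
    "\<And>k. k \<ge> N1 \<Longrightarrow> r (k + 2) powr \<theta> \<le> C * (s k + s (k + 1))"
    using eventually_error_bound by blast
  obtain N2 where N2: "\<And>k. k \<ge> N2 \<Longrightarrow> P k < 1"
    using order_tendstoD(2)[OF P_lim, of 1] unfolding eventually_sequentially by auto
  define N where "N = max N1 N2"
  define D where "D k = P k - P (k + 2)" for k
  have ss: "s (k + 2) + s (k + 3) \<le> 4 * D k" if "k \<ge> N" for k
    using N1(3)[of k] N1(3)[of "k + 1"] that unfolding D_def N_def by (simp add: numeral_3_eq_3)
  have D: "0 \<le> D k" "D k \<le> 1" if "k \<ge> N" for k
    using ss[OF that] s[of "k + 2"] s[of "k + 3"] N2[of k] P_nonneg[of "k + 2"] that
    by (auto simp: D_def N_def)
  define A where "A = 2 * C / (1 - \<theta>) * (4 * C) powr \<nu>"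
  define M' where "M' = M / (1 - \<beta>)"
  have A: "A \<ge> 0" and M': "M' \<ge> 0" using C th M beta by (auto simp: A_def M'_def)
  have main: "P (k + 2) \<le> 4 * D k + A * D k powr \<nu> + M' * \<beta> ^ k" if k: "k \<ge> N" for k
  proof -
    have "r (k + 4) powr \<theta> \<le> C * (s (k + 2) + s (k + 3))"
      using N1(4)[of "k + 2"] k unfolding N_def by (simp add: numeral_3_eq_3 numeral_eq_Suc)
    also have "\<dots> \<le> C * (4 * D k)" using ss[OF k] C by (rule mult_left_mono)
    finally have "(r (k + 4) powr \<theta>) powr \<nu> \<le> (C * (4 * D k)) powr \<nu>"
      using nu by (intro powr_mono2) auto
    then have "r (k + 4) powr (1 - \<theta>) \<le> (C * (4 * D k)) powr \<nu>"
      using th by (simp add: powr_powr \<nu>_def)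
    also have "\<dots> = (4 * C) powr \<nu> * D k powr \<nu>"
      using powr_mult[of "4 * C" "D k" \<nu>] C D[OF k] by (simp add: algebra_simps)
    finally have "2 * C / (1 - \<theta>) * r (k + 4) powr (1 - \<theta>) \<le> 2 * C / (1 - \<theta>) * ((4 * C) powr \<nu> * D k powr \<nu>)"
      using C th by (intro mult_left_mono) auto
    moreover have "M * \<beta> ^ (k + 3) / (1 - \<beta>) \<le> M' * \<beta> ^ k"
      using mult_left_mono[OF power_decreasing[of k "k + 3" \<beta>] M'] beta by (simp add: M'_def)
    moreover have "3 / 4 * s (k + 3) + 1 / 8 * s (k + 2) \<le> 4 * D k"
      using ss[OF k] s[of "k + 2"] s[of "k + 3"] by linarith
    ultimately show ?thesis unfolding P_def A_def
      by (simp add: numeral_3_eq_3 numeral_eq_Suc algebra_simps)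
  qed
  \<comment> \<open>The error bound at \<open>P k\<close> concerns \<open>W (k + 2)\<close>, hence
    the change of index.\<close>
  have shift: "\<forall>\<^sub>F k in sequentially. Q k" if "\<And>k. k \<ge> Suc N \<Longrightarrow> Q (k + 2)" for Q
  proof (rule eventually_sequentiallyI[of "N + 3"])
    fix k assume "N + 3 \<le> k"
    then have "Suc N \<le> k - 2" "k = (k - 2) + 2" by auto
    then show "Q k" using that by metis
  qed
  show ?lin if "\<theta> \<le> 1 / 2"
  proof -
    have nu1: "\<nu> \<ge> 1" using that th by (simp add: \<nu>_def field_simps)
    have "P (k + 2) \<le> (4 + A) * (P k - P (k + 2)) + M' * \<beta> ^ k" if k: "k \<ge> N" for k
    proof -
      have "D k powr \<nu> \<le> D k powr 1" using D[OF k] nu1 by (intro powr_mono') auto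
      then have "A * D k powr \<nu> \<le> A * D k" using A D[OF k] by (intro mult_left_mono) auto
      then show ?thesis using main[OF k] unfolding D_def by (simp add: algebra_simps)
    qed
    from linear_rate_two_step[of N P "4 + A" M' \<beta>, OF P_nonneg this] A M' beta
    obtain C1 \<alpha> where C1: "C1 > 0" "0 < \<alpha>" "\<alpha> < 1" "\<And>k. k \<ge> N \<Longrightarrow> P k \<le> C1 * \<alpha> ^ k"
      by auto
    have "norm (W (k + 2) - Wbar) \<le> (4 * c * C1 / \<alpha>\<^sup>2) * \<alpha> ^ (k + 2)" if "k \<ge> Suc N" for k
    proof -
      have "norm (W (k + 2) - Wbar) \<le> 4 * c * P k" using N1(2) that by (simp add: N_def)
      also have "\<dots> \<le> 4 * c * (C1 * \<alpha> ^ k)" using C1(4) that c by (intro mult_left_mono) auto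
      also have "\<dots> = (4 * c * C1 / \<alpha>\<^sup>2) * \<alpha> ^ (k + 2)"
        using C1(2) by (simp add: power2_eq_square)
      finally show ?thesis .
    qed
    then have "\<forall>\<^sub>F k in sequentially. norm (W k - Wbar) \<le> (4 * c * C1 / \<alpha>\<^sup>2) * \<alpha> ^ k"
      by (rule shift)
    then show ?thesis using C1 c
      by (intro exI[of _ "4 * c * C1 / \<alpha>\<^sup>2"] exI[of _ \<alpha>] conjI) auto
  qed
  show ?sub if "1 / 2 < \<theta>"
  proof -
    have nu1: "\<nu> < 1" using that th by (simp add: \<nu>_def field_simps)
    define \<omega> where "\<omega> = \<nu> / (1 - \<nu>)"
    have w: "\<omega> = (1 - \<theta>) / (2 * \<theta> - 1)" using that th by (simp add: \<omega>_def \<nu>_def field_simps)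
    have exponent: "- (1 - \<theta>) / (2 * \<theta> - 1) = - \<omega>"
      unfolding w by (rule minus_divide_left[symmetric])
    have w0: "\<omega> \<ge> 0" using that th by (simp add: w)
    have "P (k + 2) \<le> (4 + A) * (P k - P (k + 2)) powr \<nu> + M' * \<beta> ^ k" if k: "k \<ge> N" for k
    proof -
      have "D k powr 1 \<le> D k powr \<nu>" using D[OF k] nu1 by (intro powr_mono') auto
      then have "4 * D k \<le> 4 * D k powr \<nu>" using D[OF k] by simp
      then show ?thesis using main[OF k] unfolding D_def by (simp add: algebra_simps)
    qed
    from sublinear_rate_two_step[of N P "4 + A" \<nu> M' \<beta>, OF P_nonneg _ this] A M' beta nu nu1 D
    obtain C1 where C1: "C1 > 0" "\<And>k. k \<ge> Suc N \<Longrightarrow> P k \<le> C1 * real k powr (- \<omega>)"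
      by (auto simp: D_def \<omega>_def)
    have "norm (W (k + 2) - Wbar) \<le> (4 * c * C1 * 3 powr \<omega>) * real (k + 2) powr (- (1 - \<theta>) / (2 * \<theta> - 1))"
      if k: "k \<ge> Suc N" for k
    proof -
      have "norm (W (k + 2) - Wbar) \<le> 4 * c * P k" using N1(2) that by (simp add: N_def)
      also have "\<dots> \<le> 4 * c * (C1 * real k powr (- \<omega>))" using C1(2) that c by (intro mult_left_mono) auto
      also have "real k powr (- \<omega>) \<le> (real (k + 2) / 3) powr (- \<omega>)"
        using k w0 by (intro powr_mono2') auto
      also have "\<dots> = 3 powr \<omega> * real (k + 2) powr (- \<omega>)"
        by (subst powr_divide) (auto simp: powr_minus field_simps)
      finally show ?thesis using c C1 unfolding exponent by (simp add: mult.assoc)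
    qed
    then have "\<forall>\<^sub>F k in sequentially. norm (W k - Wbar)
        \<le> (4 * c * C1 * 3 powr \<omega>) * real k powr (- (1 - \<theta>) / (2 * \<theta> - 1))"
      by (rule shift)
    then show ?thesis using C1 c
      by (intro exI[of _ "4 * c * C1 * 3 powr \<omega>"] conjI) auto
  qed
qed

end

section \<open>Alternating proximal steps on factored matrices\<close>

text \<open>With \<open>lam / w = z powr (q + 1)\<close> and \<open>1 \<le> q + 1 \<le> 3\<close>,
  the quotient lies between 1 and \<open>z ^ 3\<close>. This replaces the exponent by a cube, for
  which \<open>3 / 4 \<le> z \<le> 5 / 4\<close> gives numerical bounds independent of
  \<open>q\<close>.\<close>

lemma weight_estimates:
  fixes lam w q \<delta> :: real
  assumes lam: "0 < lam" "0 < w" and q: "0 < q" "q \<le> 2"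
    and del: "\<bar>(lam / w) powr (1 / (q + 1)) - 1\<bar> \<le> \<delta>" "\<delta> \<le> 1 / 4"
  shows "\<bar>w - lam\<bar> \<le> 10 * lam * \<delta>" "lam / 2 \<le> w" "w \<le> 3 * lam"
proof -
  define z where "z = (lam / w) powr (1 / (q + 1))"
  define y where "y = z powr (q + 1)"
  have z: "3 / 4 \<le> z" "z \<le> 5 / 4" "\<bar>z - 1\<bar> \<le> \<delta>" using del by (auto simp: z_def)
  have y: "lam / w = y" using lam q by (simp add: y_def z_def powr_powr)
  have "y > 0" unfolding y[symmetric] using lam by simp
  then have w: "w = lam / y" "y > 0" using lam y by (auto simp: field_simps)
  have z3: "z powr 3 = z ^ 3" using z powr_realpow[of z 3] by simp
  have b: "27 / 64 \<le> y" "y \<le> 125 / 64" "\<bar>y - 1\<bar> \<le> \<bar>z ^ 3 - 1\<bar>"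
  proof -
    have p3: "27 / 64 \<le> z ^ 3" "z ^ 3 \<le> 125 / 64"
      using power_mono[OF z(1), of 3] power_mono[OF z(2), of 3] z by (auto simp: power3_eq_cube)
    have "z powr (q + 1) \<le> z powr 3 \<and> 1 \<le> z powr (q + 1)" if "z \<ge> 1"
      using that q powr_mono[of "q + 1" 3 z] ge_one_powr_ge_zero[of z "q + 1"] by auto
    moreover have "z powr 3 \<le> z powr (q + 1) \<and> z powr (q + 1) \<le> 1" if "z \<le> 1"
      using that q z powr_mono'[of "q + 1" 3 z] powr_mono'[of 0 "q + 1" z] by auto
    ultimately show "27 / 64 \<le> y" "y \<le> 125 / 64" "\<bar>y - 1\<bar> \<le> \<bar>z ^ 3 - 1\<bar>"
      using p3 unfolding y_def z3 by (cases "z \<ge> 1"; force)+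
  qed
  have "\<bar>z ^ 3 - 1\<bar> = \<bar>z - 1\<bar> * (1 + z + z\<^sup>2)"
  proof -
    have "z ^ 3 - 1 = (z - 1) * (1 + z + z\<^sup>2)" by (simp add: power2_eq_square power3_eq_cube algebra_simps)
    then show ?thesis using z by (simp add: abs_mult)
  qed
  also have "\<dots> \<le> \<delta> * 4"
  proof (rule mult_mono)
    show "1 + z + z\<^sup>2 \<le> 4" using power_mono[OF z(2), of 2] z by (simp add: power2_eq_square)
  qed (use z in auto)
  finally have y1: "\<bar>y - 1\<bar> \<le> \<delta> * 4" using b by linarith
  have "w - lam = lam * (1 - y) / y" using w by (simp add: field_simps)
  then have "\<bar>w - lam\<bar> = lam * \<bar>y - 1\<bar> / y"
    using w lam by (simp add: abs_mult abs_minus_commute)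
  \<comment> \<open>The resulting factor \<open>256 / 27\<close> is below 10.\<close>
  also have "\<dots> \<le> lam * (\<delta> * 4) / (27 / 64)"
    using b y1 lam by (intro frac_le mult_left_mono) auto
  also have "\<dots> \<le> 10 * lam * \<delta>" using lam z by (simp add: field_simps)
  finally show "\<bar>w - lam\<bar> \<le> 10 * lam * \<delta>" .
  show "lam / 2 \<le> w" "w \<le> 3 * lam"
    using w lam b by (auto simp: field_simps)
qed

section \<open>Column-separable penalties\<close>

lemma column_diff: "column t (A - B) = column t A - column t (B :: real ^ 'd ^ 'm)"
  by (simp add: column_def vec_eq_iff)

lemma bounded_linear_column: "bounded_linear (\<lambda>A :: real ^ 'd ^ 'm. column t A)"
  by (intro linear_conv_bounded_linear[THEN iffD1] linearI) (auto simp: column_def vec_eq_iff)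

lemma norm_power2_columns:
  fixes A :: "real ^ 'd ^ 'm"
  shows "(norm A)\<^sup>2 = (\<Sum>t\<in>UNIV. (norm (column t A))\<^sup>2)"
  unfolding power2_norm_eq_inner inner_vec_def column_def
  by (simp add: sum.swap[of _ "UNIV :: 'd set"])

text \<open>The penalty of a single factor, split off so that both factors share the same
  lemmas.\<close>

definition col_penalty :: "real \<Rightarrow> ('d \<Rightarrow> real) \<Rightarrow> real ^ 'd ^ 'm \<Rightarrow> real" where
  "col_penalty q w A = (\<Sum>t\<in>UNIV. w t / q * norm (column t A) powr q)"

lemma \<Phi>_cols_eq:
  "\<Phi>_cols F q p w1 w2 (U, V) = F (U ** transpose V) + col_penalty q w1 U + col_penalty p w2 V"
  by (simp add: \<Phi>_cols_def col_penalty_def)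

text \<open>The squared Frobenius norm and the penalty are both sums over columns, so columnwise
  minimizers form a minimizer of the matrix problem.\<close>

lemma prox_columns_minimizer:
  fixes X Z v :: "real ^ 'd ^ 'm"
  assumes "\<And>t. column t Z \<in> prox (\<lambda>y. w t / (q * M) * norm y powr q) (column t X)"
  shows "1 / 2 * (norm (Z - X))\<^sup>2 + col_penalty q w Z / M \<le> 1 / 2 * (norm (v - X))\<^sup>2 + col_penalty q w v / M"
proof -
  have eq: "1 / 2 * (norm (Y - X))\<^sup>2 + col_penalty q w Y / M =
    (\<Sum>t\<in>UNIV. 1 / 2 * (norm (column t Y - column t X))\<^sup>2 + w t / (q * M) * norm (column t Y) powr q)" for Y
    unfolding norm_power2_columns column_diff col_penalty_def sum.distrib sum_distrib_left sum_divide_distrib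
    by simp
  show ?thesis unfolding eq
  proof (rule sum_mono)
    fix t
    show "1 / 2 * (norm (column t Z - column t X))\<^sup>2 + w t / (q * M) * norm (column t Z) powr q
       \<le> 1 / 2 * (norm (column t v - column t X))\<^sup>2 + w t / (q * M) * norm (column t v) powr q"
      using assms[of t] unfolding prox_def is_arg_min_def mem_Collect_eq by (meson linorder_not_less)
  qed
qed

text \<open>A power of the norm is smooth away from 0, whatever its exponent; this is where the
  absence of zero columns enters.\<close>

lemma col_penalty_differentiable:
  fixes A :: "real ^ 'd ^ 'm"
  assumes "\<And>t. column t A \<noteq> 0"
  shows "col_penalty q w differentiable (at A)"
proof -
  have "(\<lambda>A. norm (column t A) powr q) differentiable (at A)" for t
  proof -
    have "((\<lambda>A. norm (column t A)) has_derivative (\<lambda>h. inner (column t h) (sgn (column t A)))) (at A)"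
      by (rule has_derivative_compose[OF bounded_linear_imp_has_derivative[OF bounded_linear_column]
          has_derivative_norm]) (use assms in auto)
    moreover have "((\<lambda>x. x powr q) has_derivative (*) (q * norm (column t A) powr (q - 1)))
        (at (norm (column t A)))"
      using assms[of t] has_real_derivative_powr[of "norm (column t A)" q]
      by (simp add: has_field_derivative_def)
    ultimately show ?thesis using has_derivative_compose differentiableI by blast
  qed
  then have "(\<lambda>A. \<Sum>t\<in>UNIV. w t / q * norm (column t A) powr q) differentiable (at A)"
    by (intro differentiable_sum ballI differentiable_mult) auto
  then show ?thesis by (simp add: col_penalty_def[abs_def])
qed

section \<open>Gradients of the factored objective\<close>

lemma bounded_bilinear_mult_transpose:
  "bounded_bilinear (\<lambda>(U :: real ^ 'd ^ 'm) (V :: real ^ 'd ^ 'n). U ** transpose V)"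
  unfolding bilinear_conv_bounded_bilinear[symmetric] bilinear_def
  by (auto intro!: linearI simp: matrix_matrix_mult_def transpose_def vec_eq_iff algebra_simps
      sum.distrib sum_distrib_left)

context
  fixes F :: "real ^ 'n ^ 'm \<Rightarrow> real"
  assumes F: "\<And>X. F differentiable (at X)"
begin

lemma GDERIV_grad_U:
  fixes U :: "real ^ 'd ^ 'm"
  shows "GDERIV (\<lambda>X. F (X ** transpose V)) U :> grad_U F U V"
  unfolding grad_U_def
proof (rule GDERIV_gradient)
  have "(\<lambda>X. X ** transpose V) differentiable (at U)"
    using bounded_bilinear.bounded_linear_left[OF bounded_bilinear_mult_transpose, of V]
      bounded_linear_imp_differentiable by blast
  then show "(\<lambda>X. F (X ** transpose V)) differentiable (at U)"
    using differentiable_chain_at[of "\<lambda>X. X ** transpose V" U F] F by (simp add: o_def)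
qed

lemma GDERIV_grad_V:
  fixes U :: "real ^ 'd ^ 'm"
  shows "GDERIV (\<lambda>Y. F (U ** transpose Y)) V :> grad_V F U V"
  unfolding grad_V_def
proof (rule GDERIV_gradient)
  have "(\<lambda>Y. U ** transpose Y) differentiable (at V)"
    using bounded_bilinear.bounded_linear_right[OF bounded_bilinear_mult_transpose, of U]
      bounded_linear_imp_differentiable by blast
  then show "(\<lambda>Y. F (U ** transpose Y)) differentiable (at V)"
    using differentiable_chain_at[of "\<lambda>Y. U ** transpose Y" V F] F by (simp add: o_def)
qed

text \<open>The chain rule yields some total derivative; its restrictions to the two factors are
  derivatives too, so uniqueness identifies them with the partial gradients.\<close>

lemma GDERIV_mult_transpose:
  fixes U :: "real ^ 'd ^ 'm" and V :: "real ^ 'd ^ 'n"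
  shows "GDERIV (\<lambda>W. F (fst W ** transpose (snd W))) (U, V) :> (grad_U F U V, grad_V F U V)"
proof -
  have "(\<lambda>W. fst W ** transpose (snd W)) differentiable (at (U, V))"
    by (rule differentiableI, rule bounded_bilinear.FDERIV[OF bounded_bilinear_mult_transpose])
      (auto intro!: derivative_eq_intros)
  then have "(\<lambda>W. F (fst W ** transpose (snd W))) differentiable (at (U, V))"
    using differentiable_chain_at[of "\<lambda>W. fst W ** transpose (snd W)" "(U, V)" F] F by (simp add: o_def)
  then obtain T where T: "((\<lambda>W. F (fst W ** transpose (snd W))) has_derivative T) (at (U, V))"
    unfolding differentiable_def by blast
  have "((\<lambda>X. (X, V)) has_derivative (\<lambda>h. (h, 0))) (at U)"
    by (auto intro!: derivative_eq_intros)
  from has_derivative_compose[OF this T]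
  have "((\<lambda>X. F (X ** transpose V)) has_derivative (\<lambda>h. T (h, 0))) (at U)" by simp
  then have 1: "(\<lambda>h. T (h, 0)) = (\<lambda>h. inner h (grad_U F U V))"
    using GDERIV_grad_U[of V U] unfolding gderiv_def by (rule has_derivative_unique)
  have "((\<lambda>Y. (U, Y)) has_derivative (\<lambda>h. (0, h))) (at V)"
    by (auto intro!: derivative_eq_intros)
  from has_derivative_compose[OF this T]
  have "((\<lambda>Y. F (U ** transpose Y)) has_derivative (\<lambda>h. T (0, h))) (at V)" by simp
  then have 2: "(\<lambda>h. T (0, h)) = (\<lambda>h. inner h (grad_V F U V))"
    using GDERIV_grad_V[of U V] unfolding gderiv_def by (rule has_derivative_unique)
  have "T h = inner h (grad_U F U V, grad_V F U V)" for h
  proof -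
    have "T h = T (fst h, 0) + T (0, snd h)"
      using linear_add[OF has_derivative_linear[OF T], of "(fst h, 0)" "(0, snd h)"] by simp
    then show ?thesis using fun_cong[OF 1, of "fst h"] fun_cong[OF 2, of "snd h"] by (simp add: inner_prod_def)
  qed
  then have "T = (\<lambda>h. inner h (grad_U F U V, grad_V F U V))" by auto
  then show ?thesis using T unfolding gderiv_def by simp
qed

lemma GDERIV_\<Phi>_cols:
  fixes U :: "real ^ 'd ^ 'm" and V :: "real ^ 'd ^ 'n"
  assumes "GDERIV (col_penalty q w1) U :> G1" "GDERIV (col_penalty p w2) V :> G2"
  shows "GDERIV (\<Phi>_cols F q p w1 w2) (U, V) :> (grad_U F U V + G1, grad_V F U V + G2)"
proof -
  have 1: "((\<lambda>W. col_penalty q w1 (fst W)) has_derivative (\<lambda>h. inner (fst h) G1)) (at (U, V))"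
    by (rule has_derivative_compose[OF bounded_linear_imp_has_derivative[OF bounded_linear_fst]])
      (use assms in \<open>simp add: gderiv_def\<close>)
  have 2: "((\<lambda>W. col_penalty p w2 (snd W)) has_derivative (\<lambda>h. inner (snd h) G2)) (at (U, V))"
    by (rule has_derivative_compose[OF bounded_linear_imp_has_derivative[OF bounded_linear_snd]])
      (use assms in \<open>simp add: gderiv_def\<close>)
  have "\<Phi>_cols F q p w1 w2 = (\<lambda>W. F (fst W ** transpose (snd W)) + col_penalty q w1 (fst W) + col_penalty p w2 (snd W))"
    by (auto simp: \<Phi>_cols_eq)
  moreover have "((\<lambda>W. F (fst W ** transpose (snd W)) + col_penalty q w1 (fst W) + col_penalty p w2 (snd W))
     has_derivative (\<lambda>h. inner h (grad_U F U V, grad_V F U V) + inner (fst h) G1 + inner (snd h) G2)) (at (U, V))"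
    by (intro has_derivative_add 1 2 GDERIV_mult_transpose[unfolded gderiv_def])
  ultimately show ?thesis unfolding gderiv_def
    by (simp add: inner_prod_def inner_add_right algebra_simps)
qed

text \<open>The decrease adds the estimates of the two half steps, whose intermediate value at
  \<open>(U2, V1)\<close> cancels. For the residual, the optimality of \<open>U2\<close> concerns
  the gradient at \<open>(U2, V1)\<close>, and moving to \<open>(U2, V2)\<close> costs
  \<open>H * norm (V2 - V1)\<close>; the second half step already ends at
  \<open>(U2, V2)\<close>.\<close>

lemma palm_step:
  fixes U0 U1 U2 :: "real ^ 'd ^ 'm" and V0 V1 V2 :: "real ^ 'd ^ 'n"
  assumes M: "M1 > 0" "M2 > 0" and x: "x \<ge> 0"
    and lip: "(M1 / 2)-lipschitz_on UNIV (\<lambda>X. grad_U F X V1)" "(M2 / 2)-lipschitz_on UNIV (\<lambda>Y. grad_V F U2 Y)"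
    and Y: "Y1 = U1 + x *\<^sub>R (U1 - U0)" "Y2 = V1 + x *\<^sub>R (V1 - V0)"
    and prox1: "\<And>t. column t U2 \<in> prox (\<lambda>y. w1 t / (q * M1) * norm y powr q)
          (column t (Y1 - (1 / M1) *\<^sub>R grad_U F Y1 V1))"
    and prox2: "\<And>t. column t V2 \<in> prox (\<lambda>y. w2 t / (p * M2) * norm y powr p)
          (column t (Y2 - (1 / M2) *\<^sub>R grad_V F U2 Y2))"
  shows palm_step_decrease: "\<Phi>_cols F q p w1 w2 (U2, V2) + (M1 / 8 * (norm (U2 - U1))\<^sup>2 + M2 / 8 * (norm (V2 - V1))\<^sup>2)
      \<le> \<Phi>_cols F q p w1 w2 (U1, V1) + (M1 * x\<^sup>2 * (norm (U1 - U0))\<^sup>2 + M2 * x\<^sup>2 * (norm (V1 - V0))\<^sup>2)"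
    and palm_step_residual: "(\<And>t. column t U2 \<noteq> 0) \<Longrightarrow> (\<And>t. column t V2 \<noteq> 0) \<Longrightarrow>
      H-lipschitz_on S (\<lambda>(X, Y). grad_U F X Y) \<Longrightarrow> (U2, V1) \<in> S \<Longrightarrow> (U2, V2) \<in> S \<Longrightarrow>
      \<exists>D. GDERIV (\<Phi>_cols F q p w1 w2) (U2, V2) :> D \<and>
        norm D \<le> H * norm (V2 - V1) + 3 / 2 * M1 * (norm (U2 - U1) + x * norm (U1 - U0))
          + 3 / 2 * M2 * (norm (V2 - V1) + x * norm (V1 - V0))"
proof -
  note min1 = prox_columns_minimizer[OF prox1] and min2 = prox_columns_minimizer[OF prox2]
  have "F (U2 ** transpose V1) + col_penalty q w1 U2 + M1 / 8 * (norm (U2 - U1))\<^sup>2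
     \<le> F (U1 ** transpose V1) + col_penalty q w1 U1 + M1 * x\<^sup>2 * (norm (U1 - U0))\<^sup>2"
    by (rule prox_gradient_decrease[OF GDERIV_grad_U lip(1) M(1) Y(1) min1])
  moreover have "F (U2 ** transpose V2) + col_penalty p w2 V2 + M2 / 8 * (norm (V2 - V1))\<^sup>2
     \<le> F (U2 ** transpose V1) + col_penalty p w2 V1 + M2 * x\<^sup>2 * (norm (V1 - V0))\<^sup>2"
    by (rule prox_gradient_decrease[OF GDERIV_grad_V lip(2) M(2) Y(2) min2])
  ultimately show "\<Phi>_cols F q p w1 w2 (U2, V2) + (M1 / 8 * (norm (U2 - U1))\<^sup>2 + M2 / 8 * (norm (V2 - V1))\<^sup>2)
      \<le> \<Phi>_cols F q p w1 w2 (U1, V1) + (M1 * x\<^sup>2 * (norm (U1 - U0))\<^sup>2 + M2 * x\<^sup>2 * (norm (V1 - V0))\<^sup>2)"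
    unfolding \<Phi>_cols_eq by linarith
next
  assume nz: "\<And>t. column t U2 \<noteq> 0" "\<And>t. column t V2 \<noteq> 0"
    and S: "H-lipschitz_on S (\<lambda>(X, Y). grad_U F X Y)" "(U2, V1) \<in> S" "(U2, V2) \<in> S"
  note min1 = prox_columns_minimizer[OF prox1] and min2 = prox_columns_minimizer[OF prox2]
  note G1 = GDERIV_gradient[OF col_penalty_differentiable[OF nz(1), of q w1]]
  note G2 = GDERIV_gradient[OF col_penalty_differentiable[OF nz(2), of p w2]]
  let ?G1 = "gradient (col_penalty q w1) U2" and ?G2 = "gradient (col_penalty p w2) V2"
  have r1: "norm (grad_U F U2 V1 + ?G1) \<le> 3 / 2 * M1 * (norm (U2 - U1) + x * norm (U1 - U0))"
    by (rule prox_gradient_residual[OF lip(1) M(1) Y(1) x G1 min1])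
  have r2: "norm (grad_V F U2 V2 + ?G2) \<le> 3 / 2 * M2 * (norm (V2 - V1) + x * norm (V1 - V0))"
    by (rule prox_gradient_residual[OF lip(2) M(2) Y(2) x G2 min2])
  have "norm (grad_U F U2 V2 - grad_U F U2 V1) \<le> H * norm (V2 - V1)"
    using lipschitz_onD[OF S(1,3,2)] by (simp add: dist_norm)
  then have "norm (grad_U F U2 V2 + ?G1) \<le> H * norm (V2 - V1) + norm (grad_U F U2 V1 + ?G1)"
    using norm_triangle_ineq[of "grad_U F U2 V2 - grad_U F U2 V1" "grad_U F U2 V1 + ?G1"] by simp
  moreover have "norm (grad_U F U2 V2 + ?G1, grad_V F U2 V2 + ?G2)
      \<le> norm (grad_U F U2 V2 + ?G1) + norm (grad_V F U2 V2 + ?G2)"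
    by (rule norm_Pair_le)
  ultimately have "norm (grad_U F U2 V2 + ?G1, grad_V F U2 V2 + ?G2)
     \<le> H * norm (V2 - V1) + 3 / 2 * M1 * (norm (U2 - U1) + x * norm (U1 - U0))
          + 3 / 2 * M2 * (norm (V2 - V1) + x * norm (V1 - V0))"
    using r1 r2 by linarith
  then show "\<exists>D. GDERIV (\<Phi>_cols F q p w1 w2) (U2, V2) :> D \<and>
        norm D \<le> H * norm (V2 - V1) + 3 / 2 * M1 * (norm (U2 - U1) + x * norm (U1 - U0))
          + 3 / 2 * M2 * (norm (V2 - V1) + x * norm (V1 - V0))"
    using GDERIV_\<Phi>_cols[OF G1 G2] by blast
qed

end

text \<open>The geometric decay falls below \<open>lam0\<close> after finitely many steps, and then
  the maximum is \<open>lam0\<close> itself. The bounds start at index 1, after the first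
  application of the rule.\<close>

lemma eventually_floor_reached:
  fixes lam :: "nat \<Rightarrow> real"
  assumes "0 < lam0" "0 < \<rho>" "\<rho> < 1" and lam: "\<And>k. lam (Suc k) = max (\<rho> * lam k) lam0"
  shows "\<forall>\<^sub>F k in sequentially. lam k = lam0"
proof -
  have bound: "lam0 \<le> lam (Suc k) \<and> lam (Suc k) \<le> max (\<rho> ^ Suc k * lam 0) lam0" for k
  proof (induction k)
    case 0
    then show ?case by (simp add: lam)
  next
    case (Suc k)
    have "\<rho> * lam (Suc k) \<le> \<rho> * max (\<rho> ^ Suc k * lam 0) lam0"
      using Suc assms by (intro mult_left_mono) auto
    also have "\<dots> \<le> max (\<rho> ^ Suc (Suc k) * lam 0) lam0"
    proof -
      have "\<rho> * lam0 \<le> lam0" using assms mult_right_mono[of \<rho> 1 lam0] by simp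
      then show ?thesis using assms(2) by (simp add: max_mult_distrib_left mult.assoc max.coboundedI2)
    qed
    finally show ?case by (simp add: lam[of "Suc k"])
  qed
  have "(\<lambda>k. \<rho> ^ Suc k * lam 0) \<longlonglongrightarrow> 0 * lam 0"
    using assms by (intro tendsto_mult tendsto_const LIMSEQ_Suc LIMSEQ_realpow_zero) auto
  then have "\<forall>\<^sub>F k in sequentially. \<rho> ^ Suc k * lam 0 < lam0"
    using assms(1) by (auto dest: order_tendstoD)
  then have "\<forall>\<^sub>F k in sequentially. lam (Suc k) = lam0"
  proof eventually_elim
    case (elim k)
    then show ?case using bound[of k] by simp
  qed
  then show ?thesis by (subst (asm) eventually_sequentially_Suc)
qed

section \<open>Dependence of the perturbed objective on weights and argument\<close>

lemma norm2_pow_nonneg: "norm2_pow q A \<ge> 0"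
  by (simp add: norm2_pow_def sum_nonneg)

lemma col_penalty_mono:
  fixes A :: "real ^ 'd ^ 'm"
  assumes "q > 0" "\<And>t. v t \<le> w t"
  shows "col_penalty q v A \<le> col_penalty q w A"
  unfolding col_penalty_def using assms by (intro sum_mono mult_right_mono divide_right_mono) auto

lemma col_penalty_const:
  fixes A :: "real ^ 'd ^ 'm"
  shows "col_penalty q (\<lambda>_. x) A = x * (norm2_pow q A / q)"
  by (simp add: col_penalty_def norm2_pow_def sum_distrib_left sum_divide_distrib)

lemma col_penalty_diff:
  fixes A :: "real ^ 'd ^ 'm"
  shows "col_penalty q w A - col_penalty q v A = col_penalty q (\<lambda>t. w t - v t) A"
  by (simp add: col_penalty_def sum_subtractf[symmetric] diff_divide_distrib left_diff_distrib)

lemma \<Phi>_cols_le: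
  fixes U :: "real ^ 'd ^ 'm" and V :: "real ^ 'd ^ 'n"
  assumes "q > 0" "p > 0" "\<And>t. w1 t \<le> x" "\<And>t. w2 t \<le> x"
  shows "\<Phi>_cols F q p w1 w2 (U, V) \<le> F (U ** transpose V) + x * (norm2_pow q U / q + norm2_pow p V / p)"
  using col_penalty_mono[of q w1 "\<lambda>_. x" U] col_penalty_mono[of p w2 "\<lambda>_. x" V] assms
  unfolding \<Phi>_cols_eq col_penalty_const distrib_left by simp

lemma \<Phi>_cols_ge:
  fixes U :: "real ^ 'd ^ 'm" and V :: "real ^ 'd ^ 'n"
  assumes "q > 0" "p > 0" "\<And>t. x \<le> w1 t" "\<And>t. x \<le> w2 t"
  shows "\<Phi>_cols F q p w1 w2 (U, V) \<ge> F (U ** transpose V) + x * (norm2_pow q U / q + norm2_pow p V / p)"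
  using col_penalty_mono[of q "\<lambda>_. x" w1 U] col_penalty_mono[of p "\<lambda>_. x" w2 V] assms
  unfolding \<Phi>_cols_eq col_penalty_const distrib_left by simp

text \<open>The objective is affine in the column weights, so \<open>F\<close> cancels and only the
  penalty enters the error.\<close>

lemma \<Phi>_cols_perturb:
  fixes U :: "real ^ 'd ^ 'm" and V :: "real ^ 'd ^ 'n"
  assumes "q > 0" "p > 0" "\<And>t. \<bar>w1 t - v1 t\<bar> \<le> x" "\<And>t. \<bar>w2 t - v2 t\<bar> \<le> x"
  shows "\<bar>\<Phi>_cols F q p w1 w2 (U, V) - \<Phi>_cols F q p v1 v2 (U, V)\<bar> \<le> x * (norm2_pow q U / q + norm2_pow p V / p)"
proof -
  have "col_penalty q (\<lambda>t. w1 t - v1 t) U \<le> x * (norm2_pow q U / q)"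
    "col_penalty q (\<lambda>t. v1 t - w1 t) U \<le> x * (norm2_pow q U / q)"
    "col_penalty p (\<lambda>t. w2 t - v2 t) V \<le> x * (norm2_pow p V / p)"
    "col_penalty p (\<lambda>t. v2 t - w2 t) V \<le> x * (norm2_pow p V / p)"
    unfolding col_penalty_const[symmetric] using assms
    by (intro col_penalty_mono; force simp: abs_le_iff)+
  then show ?thesis unfolding \<Phi>_cols_eq distrib_left col_penalty_diff[symmetric] by linarith
qed

text \<open>The weights vary with \<open>j\<close> and are only known to be bounded, so the limit
  concerns differences taken with equal weights.\<close>

lemma tendsto_col_penalty_diff:
  fixes A :: "nat \<Rightarrow> real ^ 'd ^ 'm"
  assumes q: "q > 0" and A: "A \<longlonglongrightarrow> B" and w: "\<forall>\<^sub>F j in sequentially. \<forall>t. \<bar>w j t\<bar> \<le> x"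
  shows "(\<lambda>j. col_penalty q (w j) (A j) - col_penalty q (w j) B) \<longlonglongrightarrow> 0"
proof -
  have "(\<lambda>j. w j t / q * (norm (column t (A j)) powr q - norm (column t B) powr q)) \<longlonglongrightarrow> 0" for t
  proof (rule Lim_null_comparison)
    show "\<forall>\<^sub>F j in sequentially. norm (w j t / q * (norm (column t (A j)) powr q - norm (column t B) powr q))
        \<le> x / q * \<bar>norm (column t (A j)) powr q - norm (column t B) powr q\<bar>"
      using w by eventually_elim
        (use q in \<open>simp add: abs_mult, intro mult_right_mono divide_right_mono; simp\<close>)
    have "(\<lambda>j. norm (column t (A j))) \<longlonglongrightarrow> norm (column t B)"
      by (intro tendsto_norm bounded_linear.tendsto[OF bounded_linear_column] A)
    then have "(\<lambda>j. norm (column t (A j)) powr q) \<longlonglongrightarrow> norm (column t B) powr q"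
      by (rule tendsto_powr') (use q in auto)
    then show "(\<lambda>j. x / q * \<bar>norm (column t (A j)) powr q - norm (column t B) powr q\<bar>) \<longlonglongrightarrow> 0"
      by (intro tendsto_mult_right_zero tendsto_rabs_zero LIM_zero)
  qed
  from tendsto_sum[where I = UNIV, OF this] show ?thesis
    by (simp add: col_penalty_def sum_subtractf[symmetric] right_diff_distrib)
qed

lemma tendsto_\<Phi>_cols_diff:
  fixes A :: "nat \<Rightarrow> real ^ 'd ^ 'm" and B :: "nat \<Rightarrow> real ^ 'd ^ 'n"
  assumes q: "q > 0" "p > 0" and F: "\<And>X. isCont F X"
    and lim: "(\<lambda>j. (A j, B j)) \<longlonglongrightarrow> (a, b)"
    and w: "\<forall>\<^sub>F j in sequentially. \<forall>t. \<bar>w1 j t\<bar> \<le> x" "\<forall>\<^sub>F j in sequentially. \<forall>t. \<bar>w2 j t\<bar> \<le> x"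
  shows "(\<lambda>j. \<Phi>_cols F q p (w1 j) (w2 j) (A j, B j) - \<Phi>_cols F q p (w1 j) (w2 j) (a, b)) \<longlonglongrightarrow> 0"
proof -
  have AB: "A \<longlonglongrightarrow> a" "B \<longlonglongrightarrow> b" using tendsto_fst[OF lim] tendsto_snd[OF lim] by auto
  have "(\<lambda>j. F (A j ** transpose (B j))) \<longlonglongrightarrow> F (a ** transpose b)"
    by (intro isCont_tendsto_compose[OF F] bounded_bilinear.tendsto[OF bounded_bilinear_mult_transpose] AB)
  then have "(\<lambda>j. (F (A j ** transpose (B j)) - F (a ** transpose b))
       + (col_penalty q (w1 j) (A j) - col_penalty q (w1 j) a)
       + (col_penalty p (w2 j) (B j) - col_penalty p (w2 j) b)) \<longlonglongrightarrow> 0 + 0 + 0"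
    by (intro tendsto_add tendsto_col_penalty_diff[where x = x] q AB w) (auto intro: LIM_zero)
  then show ?thesis unfolding \<Phi>_cols_eq by (simp add: algebra_simps)
qed

lemma tendsto_zero_subseq_mono:
  fixes r :: "nat \<Rightarrow> real"
  assumes f: "strict_mono f" "(\<lambda>j. r (f j)) \<longlonglongrightarrow> 0"
    and r: "\<And>k. k \<ge> K \<Longrightarrow> r k > 0" "\<And>k. k \<ge> K \<Longrightarrow> r (Suc k) \<le> r k"
  shows "r \<longlonglongrightarrow> 0"
proof (rule LIMSEQ_I)
  fix e :: real assume "e > 0"
  then have "\<forall>\<^sub>F j in sequentially. r (f j) < e" using f(2) by (auto dest: order_tendstoD)
  then have "\<forall>\<^sub>F j in sequentially. r (f j) < e \<and> j \<ge> K"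
    using eventually_ge_at_top by (rule eventually_conj)
  then obtain j where j: "r (f j) < e" "j \<ge> K" using eventually_happens'[OF sequentially_bot] by blast
  then have fj: "f j \<ge> K" using seq_suble[OF f(1), of j] by linarith
  have "r k < e" if "k \<ge> f j" for k
    using that
  proof (induction k rule: dec_induct)
    case (step k)
    then show ?case using r(2)[of k] fj by simp
  qed (use j in simp)
  then show "\<exists>N. \<forall>n\<ge>N. norm (r n - 0) < e"
    using r(1) fj by (intro exI[of _ "f j"]) (simp add: abs_of_pos)
qed

section \<open>Convergence rates of the algorithm\<close>

theorem theorem5p5:
  fixes F :: "real ^ 'n ^ 'm \<Rightarrow> real"
    and q p :: real
    and U :: "nat \<Rightarrow> real ^ 'd ^ 'm" and V :: "nat \<Rightarrow> real ^ 'd ^ 'n"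
    and k0 :: nat
    and lam0 varrho bmax :: real and lam bw L1 L2 \<delta> :: "nat \<Rightarrow> real"
    and lam1 lam2 :: "nat \<Rightarrow> 'd \<Rightarrow> real"
    and l L \<delta>\<beta> :: real
    and Ubar :: "real ^ 'd ^ 'm" and Vbar :: "real ^ 'd ^ 'n"
    and \<rho> \<theta> \<mu> Lstar :: real and \<eta> :: ereal
    and LH C0 a b \<gamma> \<beta> :: real
  assumes q: "0 < q" "q \<le> 2" and p: "0 < p" "p \<le> 2"
    and alg: "inexact_PALM F q p k0 lam0 varrho bmax lam bw L1 L2 \<delta> lam1 lam2 U V"
    and tol: "summable (\<lambda>k. sqrt (\<delta> k))"
    and A1: "\<forall>X. F differentiable (at X)" "continuous_on UNIV (gradient F)"
      "bdd_below (range F)"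
    and A2: "\<exists>W :: (real ^ 'd ^ 'm) \<times> (real ^ 'd ^ 'n). critical_point (\<Phi> F q p lam0) W"
    and A3: "\<forall>k\<ge>k0. (L1 k / 2)-lipschitz_on UNIV (\<lambda>X. grad_U F X (V k))"
      "\<forall>k\<ge>k0. (L2 k / 2)-lipschitz_on UNIV (\<lambda>Y. grad_V F (U (Suc k)) Y)"
      "0 < l" "l < L" "\<forall>k\<ge>k0. l \<le> L1 k \<and> L1 k \<le> L \<and> l \<le> L2 k \<and> L2 k \<le> L"
    and C: "\<forall>k\<ge>k0. \<Phi>_pert F q p lam1 lam2 (Suc k) (U (Suc k), V (Suc k))
                      \<le> \<Phi>_pert F q p lam1 lam2 (Suc k) (U k, V k)"
      "\<delta>\<beta> < 1"
      "\<forall>k>k0. 0 \<le> bw k \<and>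
         bw k \<le> 1 / 6 * \<delta>\<beta> * min (sqrt (L1 (k - 1) / L1 k)) (sqrt (L2 (k - 1) / L2 k))"
    and limit_point: "\<exists>r. strict_mono r \<and> (\<lambda>j. (U (r j), V (r j))) \<longlonglongrightarrow> (Ubar, Vbar)"
    and cond1: "Lstar-lipschitz_on (cball (Ubar, Vbar) (4 * \<rho>)) (\<lambda>(X, Y). grad_U F X Y)"
      "Lstar-lipschitz_on (cball (Ubar, Vbar) (4 * \<rho>)) (\<lambda>(X, Y). grad_V F X Y)"
    and cond2: "\<exists>K. \<forall>k\<ge>K.
      \<Phi>_pert F q p lam1 lam2 k (U k, V k) - \<Phi>_pert F q p lam1 lam2 k (Ubar, Vbar)
        \<ge> \<Phi>_pert F q p lam1 lam2 (Suc k) (U (Suc k), V (Suc k))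
            - \<Phi>_pert F q p lam1 lam2 (Suc k) (Ubar, Vbar) \<and>
      \<Phi>_pert F q p lam1 lam2 (Suc k) (U (Suc k), V (Suc k))
        - \<Phi>_pert F q p lam1 lam2 (Suc k) (Ubar, Vbar) > 0"
    and cond3: "\<exists>K. \<forall>k\<ge>K. KL_property (\<Phi>_pert F q p lam1 lam2 k) (Ubar, Vbar) \<rho> \<eta> \<theta> \<mu>"
    and LH: "LH = max Lstar L"
    and C0: "0 < C0" "C0 < 1 - \<delta>\<beta>"
    and a: "a = 1 / (1 - \<delta>\<beta> - C0)"
    and b: "b = \<mu> * (3 * sqrt (8 / l) * \<mu> * (1 - \<theta>) * LH) powr ((1 - \<theta>) / \<theta>) / (1 - \<delta>\<beta> - C0)"
    and rate: "0 < \<gamma>" "0 < \<beta>" "\<beta> \<le> sqrt ((a + b - 1) / (a + b))" "\<forall>k. \<delta> k \<le> \<gamma> * \<beta> ^ (2 * k)"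
  shows "(0 < \<theta> \<and> \<theta> \<le> 1 / 2 \<longrightarrow>
           (\<exists>C>0. \<exists>\<alpha>. 0 < \<alpha> \<and> \<alpha> < 1 \<and>
              (\<forall>\<^sub>F k in sequentially. norm ((U k, V k) - (Ubar, Vbar)) \<le> C * \<alpha> ^ k))) \<and>
         (1 / 2 < \<theta> \<and> \<theta> < 1 \<longrightarrow>
           (\<exists>C>0. \<forall>\<^sub>F k in sequentially.
              norm ((U k, V k) - (Ubar, Vbar)) \<le> C * real k powr (- (1 - \<theta>) / (2 * \<theta> - 1))))"

proof -

  \<comment> \<open>Parameters and late indices\<close>
  have KL0: "\<rho> > 0" "\<mu> > 0" "\<eta> > 0" "\<theta> < 1"
    using cond3 unfolding KL_property_def by (meson order_refl)+
  \<comment> \<open>As \<open>a + b > 0\<close>, the quotient under the root is below 1; the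
    tolerances thus decay geometrically.\<close>
  have beta1: "\<beta> < 1"
  proof -
    have "a > 0" using C0 by (simp add: a)
    moreover have "b \<ge> 0" using C0 KL0 by (simp add: b)
    ultimately have "(a + b - 1) / (a + b) < 1" by (simp add: divide_less_eq)
    then have "sqrt ((a + b - 1) / (a + b)) < 1" by simp
    then show ?thesis using rate(3) by linarith
  qed
  have diffF: "\<And>X. F differentiable (at X)" and contF: "\<And>X. isCont F X"
    using A1(1) differentiable_imp_continuous_within by auto
  obtain m where m: "\<And>X. m \<le> F X" using A1(3) unfolding bdd_below_def by auto
  have par: "0 < lam0" "0 < varrho" "varrho < 1" "\<And>k. lam (Suc k) = max (varrho * lam k) lam0"
    "\<And>k. 0 \<le> bw k \<and> bw k \<le> bmax" "\<And>k. 0 < L1 k \<and> 0 < L2 k" "\<And>k. 0 \<le> \<delta> k \<and> \<delta> k \<le> 1 / 4"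
    "\<delta> \<longlonglongrightarrow> 0"
    using alg unfolding inexact_PALM_def by blast+
  have it: "0 < lam1 k t" "0 < lam2 k t"
    "column t (U (Suc k)) \<in> prox (\<lambda>y. lam1 k t / (q * L1 k) * norm y powr q)
       (column t (extrapolate bw U k - (1 / L1 k) *\<^sub>R grad_U F (extrapolate bw U k) (V k)))"
    "column t (V (Suc k)) \<in> prox (\<lambda>y. lam2 k t / (p * L2 k) * norm y powr p)
       (column t (extrapolate bw V k - (1 / L2 k) *\<^sub>R grad_V F (U (Suc k)) (extrapolate bw V k)))"
    "\<bar>(lam k / lam1 k t) powr (1 / (q + 1)) - 1\<bar> \<le> \<delta> k"
    "\<bar>(lam k / lam2 k t) powr (1 / (p + 1)) - 1\<bar> \<le> \<delta> k"
    if "k \<ge> k0" for k t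
    using alg that unfolding inexact_PALM_def by blast+
  have nz: "column t (U k) \<noteq> 0" "column t (V k) \<noteq> 0" if "k \<ge> k0" "k \<ge> 1" for k t
    using alg that unfolding inexact_PALM_def by blast+

  define W where "W k = (U k, V k)" for k
  define Wbar where "Wbar = (Ubar, Vbar)"
  define r where "r k = \<Phi>_pert F q p lam1 lam2 k (W k) - \<Phi>_pert F q p lam1 lam2 k Wbar" for k
  \<comment> \<open>The factors \<open>1 / 8\<close> are those that
    \<open>palm_step_decrease\<close> leaves on the squared steps.\<close>
  define s where "s k = sqrt (L1 k / 8 * (norm (U (Suc k) - U k))\<^sup>2 + L2 k / 8 * (norm (V (Suc k) - V k))\<^sup>2)" for k
  have s0: "s k \<ge> 0" for k using par(6)[of k] by (simp add: s_def)
  have s2: "(s k)\<^sup>2 = L1 k / 8 * (norm (U (Suc k) - U k))\<^sup>2 + L2 k / 8 * (norm (V (Suc k) - V k))\<^sup>2" for k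
    unfolding s_def by (rule real_sqrt_pow2) (use par(6)[of k] in simp)

  obtain K1 where K1: "\<And>k. k \<ge> K1 \<Longrightarrow> r (Suc k) \<le> r k \<and> 0 < r (Suc k)"
    using cond2 unfolding r_def W_def Wbar_def by auto
  obtain K2 where K2: "\<And>k. k \<ge> K2 \<Longrightarrow> KL_property (\<Phi>_pert F q p lam1 lam2 k) Wbar \<rho> \<eta> \<theta> \<mu>"
    using cond3 unfolding Wbar_def by auto
  obtain K3 where K3: "\<And>k. k \<ge> K3 \<Longrightarrow> lam k = lam0"
    using eventually_floor_reached[of lam0 varrho lam, OF par(1-3)] par(4) unfolding eventually_sequentially by blast
  \<comment> \<open>The successor serves the shift by one: \<open>r k > 0\<close> comes from the
    condition at \<open>k - 1\<close>, and the objective with index \<open>k\<close> carries the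
    weights of iteration \<open>k - 1\<close>, which must be at least \<open>k0\<close>.\<close>
  define K4 where "K4 = Suc (K1 + K2 + K3 + k0)"
  have r_pos: "r k > 0" and r_dec: "r (Suc k) \<le> r k" if "k \<ge> K4" for k
    using K1[of "k - 1"] K1[of k] that by (auto simp: K4_def)

  have wt: "\<bar>lam1 k t - lam0\<bar> \<le> 10 * lam0 * \<delta> k" "lam0 / 2 \<le> lam1 k t" "lam1 k t \<le> 3 * lam0"
    "\<bar>lam2 k t - lam0\<bar> \<le> 10 * lam0 * \<delta> k" "lam0 / 2 \<le> lam2 k t" "lam2 k t \<le> 3 * lam0"
    if k: "k + 1 \<ge> K4" for k t
  proof -
    have k: "k \<ge> k0" "lam k = lam0" using k K3[of k] by (auto simp: K4_def)
    note e1 = weight_estimates[OF par(1) it(1)[OF k(1)] q, of t "\<delta> k"]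
    note e2 = weight_estimates[OF par(1) it(2)[OF k(1)] p, of t "\<delta> k"]
    show "\<bar>lam1 k t - lam0\<bar> \<le> 10 * lam0 * \<delta> k" "lam0 / 2 \<le> lam1 k t" "lam1 k t \<le> 3 * lam0"
      using e1 it(5)[OF k(1), of t] par(7)[of k] k(2) by auto
    show "\<bar>lam2 k t - lam0\<bar> \<le> 10 * lam0 * \<delta> k" "lam0 / 2 \<le> lam2 k t" "lam2 k t \<le> 3 * lam0"
      using e2 it(6)[OF k(1), of t] par(7)[of k] k(2) by auto
  qed

  \<comment> \<open>Boundedness of the penalties\<close>
  define N where "N k = norm2_pow q (U k) / q + norm2_pow p (V k) / p" for k
  define Nbar where "Nbar = norm2_pow q Ubar / q + norm2_pow p Vbar / p"
  have N0: "N k \<ge> 0" "Nbar \<ge> 0" for k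
    using q(1) p(1) by (simp_all add: N_def Nbar_def norm2_pow_nonneg)
  \<comment> \<open>The excess is at most \<open>r K4\<close>, the objective at the limit point is
    bounded as its weights are at most \<open>3 * lam0\<close>, and \<open>F\<close> is at least
    \<open>m\<close>. Weights of at least \<open>lam0 / 2\<close> leave the bound for the
    penalty.\<close>
  define B where "B = 2 / lam0 * (r K4 + (F (Ubar ** transpose Vbar) + 3 * lam0 * Nbar) - m)"
  have NB: "N k \<le> B" if k: "k \<ge> K4" for k
  proof -
    have k': "(k - 1) + 1 \<ge> K4" using k by simp
    have "r k \<le> r K4" using k by (induction k rule: dec_induct) (use r_dec order_trans in blast)+
    moreover have "\<Phi>_pert F q p lam1 lam2 k Wbar \<le> F (Ubar ** transpose Vbar) + 3 * lam0 * Nbar"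
      unfolding \<Phi>_pert_def Wbar_def Nbar_def by (rule \<Phi>_cols_le) (use q p wt[OF k'] in auto)
    moreover have "\<Phi>_pert F q p lam1 lam2 k (W k) \<ge> F (U k ** transpose (V k)) + lam0 / 2 * N k"
      unfolding \<Phi>_pert_def W_def N_def by (rule \<Phi>_cols_ge) (use q p wt[OF k'] in auto)
    ultimately have "lam0 / 2 * N k \<le> r K4 + (F (Ubar ** transpose Vbar) + 3 * lam0 * Nbar) - m"
      using m[of "U k ** transpose (V k)"] unfolding r_def by linarith
    then show ?thesis using par(1) by (simp add: B_def field_simps)
  qed
  have B0: "B \<ge> 0" using NB[of K4] N0(1)[of K4] by simp

  \<comment> \<open>Vanishing of the excess\<close>
  obtain f where f: "strict_mono f" "(\<lambda>j. W (f j)) \<longlonglongrightarrow> Wbar"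
    using limit_point unfolding W_def Wbar_def by blast
  have r_lim: "r \<longlonglongrightarrow> 0"
  \<comment> \<open>Continuity with bounded weights gives the limit along the subsequence;
    monotonicity extends it to the whole sequence.\<close>
  proof (rule tendsto_zero_subseq_mono[OF f(1)])
    have ev: "\<forall>\<^sub>F j in sequentially. (f j - 1) + 1 \<ge> K4"
    proof (rule eventually_sequentiallyI[of K4])
      fix j assume "j \<ge> K4"
      then show "(f j - 1) + 1 \<ge> K4" using seq_suble[OF f(1), of j] by linarith
    qed
    have "\<bar>lam1 k t\<bar> \<le> 3 * lam0 \<and> \<bar>lam2 k t\<bar> \<le> 3 * lam0" if "k + 1 \<ge> K4" for k t
      using wt[OF that, of t] par(1) by auto
    then have "\<forall>\<^sub>F j in sequentially. \<forall>t. \<bar>lam1 (f j - 1) t\<bar> \<le> 3 * lam0"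
      "\<forall>\<^sub>F j in sequentially. \<forall>t. \<bar>lam2 (f j - 1) t\<bar> \<le> 3 * lam0"
      using ev by (auto elim!: eventually_mono)
    from tendsto_\<Phi>_cols_diff[OF q(1) p(1) contF f(2)[unfolded W_def Wbar_def] this]
    show "(\<lambda>j. r (f j)) \<longlonglongrightarrow> 0"
      unfolding r_def \<Phi>_pert_def W_def Wbar_def .
  qed (use r_pos r_dec in auto)

  have "\<exists>K5. \<forall>k\<ge>K5. ereal (r k) < \<eta>"
  proof (cases \<eta>)
    case (real x)
    then show ?thesis using order_tendstoD(2)[OF r_lim, of x] KL0(3) by (auto simp: eventually_sequentially)
  qed (use KL0(3) in auto)
  then obtain K5 where K5: "\<And>k. k \<ge> K5 \<Longrightarrow> ereal (r k) < \<eta>" by blast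

  \<comment> \<open>Step lengths and sufficient decrease\<close>
  define K where "K = K4 + K5"
  define c where "c = sqrt (8 / l)"
  have c: "c > 0" using A3(3) by (simp add: c_def)
  have step: "norm (W (Suc k) - W k) \<le> c * s k" if "k \<ge> k0" for k
  proof (rule power2_le_imp_le)
    have "l * (norm (W (Suc k) - W k))\<^sup>2 = l * (norm (U (Suc k) - U k))\<^sup>2 + l * (norm (V (Suc k) - V k))\<^sup>2"
      by (simp add: W_def norm_Pair distrib_left)
    also have "\<dots> \<le> L1 k * (norm (U (Suc k) - U k))\<^sup>2 + L2 k * (norm (V (Suc k) - V k))\<^sup>2"
      using A3(5) that by (intro add_mono mult_right_mono) auto
    also have "\<dots> = 8 * (s k)\<^sup>2" by (simp add: s2)
    finally show "(norm (W (Suc k) - W k))\<^sup>2 \<le> (c * s k)\<^sup>2"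
      using A3(3) by (simp add: c_def power_mult_distrib field_simps)
  qed (use c s0 in simp)
  have stepU: "norm (U (Suc k) - U k) \<le> c * s k" and stepV: "norm (V (Suc k) - V k) \<le> c * s k"
    if "k \<ge> k0" for k
    using step[OF that] norm_fst_le[of "U (Suc k) - U k" "V (Suc k) - V k"]
      norm_snd_le[of "V (Suc k) - V k" "U (Suc k) - U k"] unfolding W_def by auto

  \<comment> \<open>Between iterations \<open>k\<close> and \<open>k + 1\<close> the weights change
    by at most \<open>10 * lam0\<close> times the sum of two tolerances, each at most
    \<open>\<gamma> * \<beta> ^ (2 * k)\<close>. The change is felt at the iterate and at the limit
    point, hence \<open>B + Nbar\<close>; the root is taken because the error enters as a
    square.\<close>
  define M where "M = sqrt (20 * lam0 * \<gamma> * (B + Nbar))"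
  have M0: "0 \<le> 20 * lam0 * \<gamma> * (B + Nbar)" using par(1) rate(1) B0 N0 by simp
  have dec: "(s (Suc k))\<^sup>2 \<le> (s k)\<^sup>2 / 4 + (r (Suc k) - r (Suc (Suc k))) + (M * \<beta> ^ k)\<^sup>2" if k: "k \<ge> K" for k
  proof -
    have k0: "k \<ge> k0" "Suc k \<ge> k0" "Suc k > k0" "k \<ge> K4" using k by (auto simp: K_def K4_def)
    have d: "\<Phi>_cols F q p (lam1 (Suc k)) (lam2 (Suc k)) (U (Suc (Suc k)), V (Suc (Suc k))) + (s (Suc k))\<^sup>2
       \<le> \<Phi>_cols F q p (lam1 (Suc k)) (lam2 (Suc k)) (U (Suc k), V (Suc k))
         + (L1 (Suc k) * (bw (Suc k))\<^sup>2 * (norm (U (Suc k) - U k))\<^sup>2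
            + L2 (Suc k) * (bw (Suc k))\<^sup>2 * (norm (V (Suc k) - V k))\<^sup>2)"
      unfolding s2
      by (rule palm_step_decrease[OF diffF _ _ _ A3(1)[rule_format, OF k0(2)] A3(2)[rule_format, OF k0(2)]
            _ _ it(3)[OF k0(2)] it(4)[OF k0(2)]])
        (use par(5)[of "Suc k"] par(6)[of "Suc k"] in \<open>auto simp: extrapolate_def\<close>)
    have bw: "bw (Suc k) \<le> 1 / 6 * sqrt (L1 k / L1 (Suc k))" "bw (Suc k) \<le> 1 / 6 * sqrt (L2 k / L2 (Suc k))"
    proof -
      let ?mn = "min (sqrt (L1 k / L1 (Suc k))) (sqrt (L2 k / L2 (Suc k)))"
      have "?mn \<ge> 0" using par(6)[of k] par(6)[of "Suc k"] by (simp add: less_imp_le)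
      then have "\<delta>\<beta> * ?mn \<le> 1 * ?mn" using C(2) by (intro mult_right_mono) auto
      then show "bw (Suc k) \<le> 1 / 6 * sqrt (L1 k / L1 (Suc k))" "bw (Suc k) \<le> 1 / 6 * sqrt (L2 k / L2 (Suc k))"
        using C(3)[rule_format, OF k0(3)] by auto
    qed
    \<comment> \<open>The factor \<open>1 / 6\<close> yields \<open>1 / 36\<close>; rounding up to
      \<open>1 / 32\<close> makes the extrapolation terms a quarter of
      \<open>(s k)\<^sup>2\<close>.\<close>
    have bw2: "y * (bw (Suc k))\<^sup>2 \<le> x / 32" if "bw (Suc k) \<le> 1 / 6 * sqrt (x / y)" "x > 0" "y > 0" for x y
    proof -
      have "(bw (Suc k))\<^sup>2 \<le> (1 / 6 * sqrt (x / y))\<^sup>2"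
        using that(1) par(5) by (intro power_mono) auto
      also have "\<dots> = x / (36 * y)" using that by (simp add: power_mult_distrib power_divide)
      finally have "y * (bw (Suc k))\<^sup>2 \<le> y * (x / (36 * y))" using that by (intro mult_left_mono) auto
      also have "\<dots> = x / 36" using that by simp
      also have "\<dots> \<le> x / 32" using that by simp
      finally show ?thesis .
    qed
    have "L1 (Suc k) * (bw (Suc k))\<^sup>2 * (norm (U (Suc k) - U k))\<^sup>2
            + L2 (Suc k) * (bw (Suc k))\<^sup>2 * (norm (V (Suc k) - V k))\<^sup>2
        \<le> L1 k / 32 * (norm (U (Suc k) - U k))\<^sup>2 + L2 k / 32 * (norm (V (Suc k) - V k))\<^sup>2"
      using bw2[OF bw(1)] bw2[OF bw(2)] par(6)[of k] par(6)[of "Suc k"]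
      by (intro add_mono mult_right_mono) auto
    also have "\<dots> = (s k)\<^sup>2 / 4" unfolding s2 by simp
    finally have d2: "L1 (Suc k) * (bw (Suc k))\<^sup>2 * (norm (U (Suc k) - U k))\<^sup>2
            + L2 (Suc k) * (bw (Suc k))\<^sup>2 * (norm (V (Suc k) - V k))\<^sup>2 \<le> (s k)\<^sup>2 / 4" .
    \<comment> \<open>Both sets of weights are compared with \<open>lam0\<close>. The decrease
      \<open>d\<close> uses the weights of iteration \<open>k + 1\<close> throughout, whereas
      \<open>r (Suc k)\<close> uses those of iteration \<open>k\<close>.\<close>
    define x where "x = 10 * lam0 * (\<delta> (Suc k) + \<delta> k)"
    have x: "\<bar>lam1 (Suc k) t - lam1 k t\<bar> \<le> x" "\<bar>lam2 (Suc k) t - lam2 k t\<bar> \<le> x" for t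
      using wt(1,4)[of k t] wt(1,4)[of "Suc k" t] k0(4) unfolding x_def distrib_left by auto
    have p1: "\<Phi>_cols F q p (lam1 (Suc k)) (lam2 (Suc k)) (W (Suc k)) - \<Phi>_cols F q p (lam1 k) (lam2 k) (W (Suc k))
        \<le> x * N (Suc k)"
      using \<Phi>_cols_perturb[of q p "lam1 (Suc k)" "lam1 k" x "lam2 (Suc k)" "lam2 k" F "U (Suc k)" "V (Suc k)"]
        x q(1) p(1) unfolding W_def N_def by (simp add: abs_le_iff)
    have p2: "\<Phi>_cols F q p (lam1 k) (lam2 k) Wbar - \<Phi>_cols F q p (lam1 (Suc k)) (lam2 (Suc k)) Wbar \<le> x * Nbar"
      using \<Phi>_cols_perturb[of q p "lam1 (Suc k)" "lam1 k" x "lam2 (Suc k)" "lam2 k" F Ubar Vbar]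
        x q(1) p(1) unfolding Wbar_def Nbar_def by (simp add: abs_le_iff)
    have dk: "\<delta> k \<le> \<gamma> * (\<beta> ^ k)\<^sup>2" "\<delta> (Suc k) \<le> \<gamma> * (\<beta> ^ k)\<^sup>2"
    proof -
      show "\<delta> k \<le> \<gamma> * (\<beta> ^ k)\<^sup>2" using rate(4)[rule_format, of k] by (simp add: power_mult[symmetric] mult.commute)
      have "\<delta> (Suc k) \<le> \<gamma> * \<beta> ^ (2 * Suc k)" using rate(4) by blast
      also have "\<dots> \<le> \<gamma> * \<beta> ^ (2 * k)" using rate(1,2) beta1 by (intro mult_left_mono power_decreasing) auto
      finally show "\<delta> (Suc k) \<le> \<gamma> * (\<beta> ^ k)\<^sup>2" by (simp add: power_mult[symmetric] mult.commute)
    qed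
    have "x * N (Suc k) + x * Nbar = x * (N (Suc k) + Nbar)" by (simp add: distrib_left)
    also have "\<dots> \<le> (10 * lam0 * (2 * (\<gamma> * (\<beta> ^ k)\<^sup>2))) * (B + Nbar)"
      unfolding x_def
      by (intro mult_mono) (use dk par(1) par(7)[of k] par(7)[of "Suc k"] NB[of "Suc k"] k0 N0 B0 rate(1) in \<open>auto intro!: mult_left_mono\<close>)
    also have "\<dots> = (M * \<beta> ^ k)\<^sup>2" unfolding M_def using M0 by (simp add: power_mult_distrib)
    finally have "x * N (Suc k) + x * Nbar \<le> (M * \<beta> ^ k)\<^sup>2" .
    then show ?thesis using d d2 p1 p2 unfolding r_def \<Phi>_pert_def W_def by simp
  qed

  \<comment> \<open>Gradient bound and Kurdyka-Lojasiewicz inequality\<close>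
  have Ls0: "0 \<le> Lstar" using cond1(1) by (rule lipschitz_on_nonneg)
  \<comment> \<open>\<open>Lstar\<close> pays for moving the gradient in \<open>U\<close> to the new
    \<open>V\<close>, and \<open>3 * L\<close> collects the residuals \<open>3 / 2 * L\<close> of
    the two half steps.\<close>
  define C1 where "C1 = (Lstar + 3 * L * (1 + bmax)) * c"
  have bmax: "bmax \<ge> 0" using par(5)[of 0] by linarith
  have C1: "C1 \<ge> 0" using Ls0 A3(3,4) bmax c by (simp add: C1_def)
  have KL: "r (k + 2) powr \<theta> \<le> \<mu> * (1 - \<theta>) * C1 * (s k + s (k + 1))"
    if k: "k \<ge> K" and ball: "norm (W (k + 1) - Wbar) \<le> \<rho>" "norm (W (k + 2) - Wbar) \<le> \<rho>" for k
  proof -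
    have k0: "k \<ge> k0" "Suc k \<ge> k0" "k \<ge> K4" using k by (auto simp: K_def K4_def)
    \<comment> \<open>The mixed pair is not an iterate, so it may leave the ball of radius \<rho>;
      its distance is at most \<open>2 * \<rho>\<close>, which the larger ball covers.\<close>
    have inb: "(U (k + 2), V (k + 1)) \<in> cball (Ubar, Vbar) (4 * \<rho>)" "(U (k + 2), V (k + 2)) \<in> cball (Ubar, Vbar) (4 * \<rho>)"
    proof -
      have n: "norm (U (k + 2) - Ubar) \<le> \<rho>" "norm (V (k + 1) - Vbar) \<le> \<rho>" "norm (V (k + 2) - Vbar) \<le> \<rho>"
        using ball norm_fst_le[of "U (k + 2) - Ubar" "V (k + 2) - Vbar"]
          norm_snd_le[of "V (k + 1) - Vbar" "U (k + 1) - Ubar"]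
          norm_snd_le[of "V (k + 2) - Vbar" "U (k + 2) - Ubar"] unfolding W_def Wbar_def by auto
      have "norm (U (k + 2) - Ubar, V (k + 1) - Vbar) \<le> 4 * \<rho>" "norm (U (k + 2) - Ubar, V (k + 2) - Vbar) \<le> 4 * \<rho>"
        using n KL0(1) norm_Pair_le[of "U (k + 2) - Ubar" "V (k + 1) - Vbar"]
          norm_Pair_le[of "U (k + 2) - Ubar" "V (k + 2) - Vbar"] by linarith+
      then show "(U (k + 2), V (k + 1)) \<in> cball (Ubar, Vbar) (4 * \<rho>)" "(U (k + 2), V (k + 2)) \<in> cball (Ubar, Vbar) (4 * \<rho>)"
        unfolding mem_cball dist_commute[of "(Ubar, Vbar)"] by (simp_all add: dist_norm)
    qed
    have "\<exists>D. GDERIV (\<Phi>_cols F q p (lam1 (Suc k)) (lam2 (Suc k))) (U (Suc (Suc k)), V (Suc (Suc k))) :> D \<and>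
        norm D \<le> Lstar * norm (V (Suc (Suc k)) - V (Suc k))
          + 3 / 2 * L1 (Suc k) * (norm (U (Suc (Suc k)) - U (Suc k)) + bw (Suc k) * norm (U (Suc k) - U k))
          + 3 / 2 * L2 (Suc k) * (norm (V (Suc (Suc k)) - V (Suc k)) + bw (Suc k) * norm (V (Suc k) - V k))"
      by (rule palm_step_residual[OF diffF _ _ _ A3(1)[rule_format, OF k0(2)] A3(2)[rule_format, OF k0(2)]
            _ _ it(3)[OF k0(2)] it(4)[OF k0(2)] _ _ cond1(1)])
        (use par(5)[of "Suc k"] par(6)[of "Suc k"] inb k0 nz[of "Suc (Suc k)"] in \<open>auto simp: extrapolate_def\<close>)
    then obtain D where D: "GDERIV (\<Phi>_cols F q p (lam1 (Suc k)) (lam2 (Suc k))) (U (Suc (Suc k)), V (Suc (Suc k))) :> D"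
      "norm D \<le> Lstar * norm (V (Suc (Suc k)) - V (Suc k))
          + 3 / 2 * L1 (Suc k) * (norm (U (Suc (Suc k)) - U (Suc k)) + bw (Suc k) * norm (U (Suc k) - U k))
          + 3 / 2 * L2 (Suc k) * (norm (V (Suc (Suc k)) - V (Suc k)) + bw (Suc k) * norm (V (Suc k) - V k))"
      by blast
    note D(2)
    also have "\<dots> \<le> Lstar * (c * s (Suc k)) + 3 / 2 * L * (c * s (Suc k) + bmax * (c * s k))
        + 3 / 2 * L * (c * s (Suc k) + bmax * (c * s k))"
      using stepU[OF k0(1)] stepV[OF k0(1)] stepU[OF k0(2)] stepV[OF k0(2)] Ls0 par(5)[of "Suc k"] par(6)[of "Suc k"]
        A3(3,4) A3(5)[rule_format, OF k0(2)] bmax c s0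
      by (intro add_mono mult_mono mult_left_mono) auto
    also have "\<dots> = (Lstar * c + 3 * L * c) * s (Suc k) + 3 * L * bmax * c * s k"
      by (simp add: algebra_simps)
    also have "\<dots> \<le> C1 * s (Suc k) + C1 * s k"
      unfolding C1_def using Ls0 A3(3,4) bmax c s0
      by (intro add_mono mult_right_mono) (auto simp: algebra_simps)
    finally have nD: "norm D \<le> C1 * (s k + s (k + 1))" by (simp add: distrib_left)
    have "r (k + 2) powr \<theta> \<le> \<mu> * (1 - \<theta>) * norm D"
      unfolding r_def
    proof (rule KL_property_gderiv)
      show "KL_property (\<Phi>_pert F q p lam1 lam2 (k + 2)) Wbar \<rho> \<eta> \<theta> \<mu>"
        using K2 k by (simp add: K_def K4_def)
      show "GDERIV (\<Phi>_pert F q p lam1 lam2 (k + 2)) (W (k + 2)) :> D"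
        using D(1) unfolding \<Phi>_pert_def W_def by simp
      show "\<Phi>_pert F q p lam1 lam2 (k + 2) Wbar < \<Phi>_pert F q p lam1 lam2 (k + 2) (W (k + 2))"
        using r_pos[of "k + 2"] k0 by (simp add: r_def)
      show "ereal (\<Phi>_pert F q p lam1 lam2 (k + 2) (W (k + 2))) < ereal (\<Phi>_pert F q p lam1 lam2 (k + 2) Wbar) + \<eta>"
        using K5[of "k + 2"] k unfolding r_def K_def
        by (cases \<eta>) auto
    qed (rule ball)
    also have "\<dots> \<le> \<mu> * (1 - \<theta>) * (C1 * (s k + s (k + 1)))"
      using nD KL0 by (intro mult_left_mono) auto
    finally show ?thesis by (simp add: mult.assoc)
  qed

  \<comment> \<open>Application of the abstract rates\<close>
  have desc: "KL_descent W Wbar s r K c (\<mu> * (1 - \<theta>) * C1) M \<beta> \<theta> \<rho>" if "0 < \<theta>"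
  proof
    show "\<rho> > 0" "0 < \<theta>" "\<theta> < 1" "0 < \<beta>" "\<beta> < 1" "c > 0" "\<mu> * (1 - \<theta>) * C1 \<ge> 0" "M \<ge> 0"
      using KL0 that rate(2) beta1 c C1 M0 by (auto simp: M_def)
    show "s k \<ge> 0" for k by (rule s0)
    show "norm (W (Suc k) - W k) \<le> c * s k" "r k > 0" "r (Suc k) \<le> r k" if "k \<ge> K" for k
      using step[of k] r_pos[of k] r_dec[of k] that by (auto simp: K_def K4_def)
    show "\<exists>f. strict_mono f \<and> (\<lambda>j. W (f j)) \<longlonglongrightarrow> Wbar" using f by blast
  qed (use r_lim dec KL in auto)
  show ?thesis
  proof (intro conjI impI)
    assume th: "0 < \<theta> \<and> \<theta> \<le> 1 / 2"
    then show "\<exists>C>0. \<exists>\<alpha>. 0 < \<alpha> \<and> \<alpha> < 1 \<and>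
        (\<forall>\<^sub>F k in sequentially. norm ((U k, V k) - (Ubar, Vbar)) \<le> C * \<alpha> ^ k)"
      using KL_descent.rates(1)[OF desc] unfolding W_def Wbar_def by blast
  next
    assume th: "1 / 2 < \<theta> \<and> \<theta> < 1"
    then have "0 < \<theta>" by linarith
    then show "\<exists>C>0. \<forall>\<^sub>F k in sequentially.
        norm ((U k, V k) - (Ubar, Vbar)) \<le> C * real k powr (- (1 - \<theta>) / (2 * \<theta> - 1))"
      using KL_descent.rates(2)[OF desc] th unfolding W_def Wbar_def by blast
  qed
qed

end
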